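(* Let $a\in L^1(I)$. The following identities between Green's functions hold for all $(t,s)\in I\times I$, each one whenever all the boundary value problems whose Green's functions appear in it are nonresonant: 1. $G_{M_1}[a,T](t,s)=G_A[\tilde a,2T](t,s)-G_A[\tilde a,2T](2T-t,s)$. 2. $G_{M_1}[a,T](t,s)=G_N[\tilde a,2T](t,s)-G_N[\tilde a,2T](2T-t,s)$. 3. $G_{M_1}[a,T](t,s)=G_P[\tilde{\tilde a},4T](t,s)+G_P[\tilde{\tilde a},4T](4T-t,s)-G_P[\tilde{\tilde a},4T](2T-t,s)-G_P[\tilde{\tilde a},4T](2T+t,s)$. 4. $G_{M_2}[a,T](t,s)=G_A[\tilde a,2T](t,s)+G_A[\tilde a,2T](2T-t,s)$. 5. $G_{M_2}[a,T](t,s)=G_D[\tilde a,2T](t,s)+G_D[\tilde a,2T](2T-t,s)$. 6. $G_{M_2}[a,T](t,s)=G_P[\tilde{\tilde a},4T](t,s)-G_P[\tilde{\tilde a},4T](4T-t,s)+G_P[\tilde{\tilde a},4T](2T-t,s)-G_P[\tilde{\tilde a},4T](2T+t,s)$.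
   Context: Fix $T>0$ and put $I=[0,T]$. $W^{2,1}(c,d)$ is the set of $u\in C^1[c,d]$ with $u'$ absolutely continuous on $[c,d]$. For $a\in L^1(I)$, $\tilde a$ is its even extension to $[0,2T]$: $\tilde a(t)=a(t)$ on $[0,T]$, $\tilde a(t)=a(2T-t)$ on $(T,2T]$; and $\tilde{\tilde a}$ is the even extension of $\tilde a$ to $[0,4T]$: $\tilde{\tilde a}(t)=\tilde a(t)$ on $[0,2T]$, $\tilde{\tilde a}(t)=\tilde a(4T-t)$ on $(2T,4T]$. For $S>0$ and $q\in L^1(0,S)$ consider $u''(t)+q(t)u(t)=\sigma(t)$ for a.e. $t\in[0,S]$, $u\in W^{2,1}(0,S)$, with one of the boundary conditions: (P) periodic: $u(0)=u(S)$, $u'(0)=u'(S)$; (A) anti-periodic: $u(0)=-u(S)$, $u'(0)=-u'(S)$; (N) Neumann: $u'(0)=u'(S)=0$; (D) Dirichlet: $u(0)=u(S)=0$; ($M_1$) mixed: $u'(0)=u(S)=0$; ($M_2$) mixed: $u(0)=u'(S)=0$. The problem is nonresonant if for $\sigma=0$ it has only the trivial solution; then for every $\sigma\in L^1(0,S)$ it has a unique solution, given by $u(t)=\int_0^S G_B[q,S](t,s)\sigma(s)\,ds$ with $B\in\{P,A,N,D,M_1,M_2\}$, where $G_B[q,S]$ is the (unique, continuous on $[0,S]\times[0,S]$) Green's function. *)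

theory Defs
  imports "HOL-Analysis.Analysis"
begin

text \<open>
  Functions on a compact interval are total functions whose values outside the interval are
  irrelevant; \<open>L\<^sup>1(0,S)\<close> is \<open>absolutely_integrable_on {0..S}\<close> (Lebesgue integrability).
\<close>

definition abs_cont_on :: "real \<Rightarrow> real \<Rightarrow> (real \<Rightarrow> real) \<Rightarrow> bool" where
  "abs_cont_on c d f \<longleftrightarrow>
     (\<forall>\<epsilon>>0. \<exists>\<delta>>0. \<forall>(n::nat) \<alpha> \<beta>.
        (\<forall>i<n. c \<le> \<alpha> i \<and> \<alpha> i \<le> \<beta> i \<and> \<beta> i \<le> d) \<and>
        disjoint_family_on (\<lambda>i. {\<alpha> i<..<\<beta> i}) {..<n} \<and>
        (\<Sum>i<n. \<beta> i - \<alpha> i) < \<delta>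
        \<longrightarrow> (\<Sum>i<n. \<bar>f (\<beta> i) - f (\<alpha> i)\<bar>) < \<epsilon>)"

text \<open>The derivative relative to \<open>[c,d]\<close>, one-sided at the end points.\<close>

definition deriv_on :: "real \<Rightarrow> real \<Rightarrow> (real \<Rightarrow> real) \<Rightarrow> real \<Rightarrow> real" where
  "deriv_on c d u t = vector_derivative u (at t within {c..d})"

definition W21 :: "real \<Rightarrow> real \<Rightarrow> (real \<Rightarrow> real) set" where
  "W21 c d = {u. u differentiable_on {c..d} \<and> continuous_on {c..d} (deriv_on c d u) \<and>
                 abs_cont_on c d (deriv_on c d u)}"

datatype bc = Periodic | Antiperiodic | Neumann | Dirichlet | Mixed1 | Mixed2

fun boundary :: "bc \<Rightarrow> real \<Rightarrow> (real \<Rightarrow> real) \<Rightarrow> bool" where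
  "boundary Periodic S u \<longleftrightarrow> u 0 = u S \<and> deriv_on 0 S u 0 = deriv_on 0 S u S"
| "boundary Antiperiodic S u \<longleftrightarrow> u 0 = - u S \<and> deriv_on 0 S u 0 = - deriv_on 0 S u S"
| "boundary Neumann S u \<longleftrightarrow> deriv_on 0 S u 0 = 0 \<and> deriv_on 0 S u S = 0"
| "boundary Dirichlet S u \<longleftrightarrow> u 0 = 0 \<and> u S = 0"
| "boundary Mixed1 S u \<longleftrightarrow> deriv_on 0 S u 0 = 0 \<and> u S = 0"
| "boundary Mixed2 S u \<longleftrightarrow> u 0 = 0 \<and> deriv_on 0 S u S = 0"

text \<open>
  The differential equation \<open>u'' + q u = \<sigma>\<close> a.e. is expressed by saying that, for a.e. \<open>t\<close>, \<open>u'\<close> has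
  derivative \<open>\<sigma> t - q t * u t\<close> at \<open>t\<close>; thus the existence of \<open>u'' t\<close> is part of the condition.
\<close>

definition bvp_solution ::
    "bc \<Rightarrow> (real \<Rightarrow> real) \<Rightarrow> real \<Rightarrow> (real \<Rightarrow> real) \<Rightarrow> (real \<Rightarrow> real) \<Rightarrow> bool" where
  "bvp_solution B q S \<sigma> u \<longleftrightarrow>
     u \<in> W21 0 S \<and>
     (AE t in lebesgue. t \<in> {0..S} \<longrightarrow>
        (deriv_on 0 S u has_real_derivative (\<sigma> t - q t * u t)) (at t within {0..S})) \<and>
     boundary B S u"

definition nonresonant :: "bc \<Rightarrow> (real \<Rightarrow> real) \<Rightarrow> real \<Rightarrow> bool" where
  "nonresonant B q S \<longleftrightarrow>
     (\<forall>u. bvp_solution B q S (\<lambda>_. 0) u \<longrightarrow> (\<forall>t\<in>{0..S}. u t = 0))"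

definition is_green :: "bc \<Rightarrow> (real \<Rightarrow> real) \<Rightarrow> real \<Rightarrow> (real \<Rightarrow> real \<Rightarrow> real) \<Rightarrow> bool" where
  "is_green B q S G \<longleftrightarrow>
     continuous_on ({0..S} \<times> {0..S}) (\<lambda>(t, s). G t s) \<and>
     (\<forall>\<sigma>. \<sigma> absolutely_integrable_on {0..S} \<longrightarrow>
        bvp_solution B q S \<sigma> (\<lambda>t. integral {0..S} (\<lambda>s. G t s * \<sigma> s)))"

text \<open>
  In the nonresonant case a Green's function exists and its values on \<open>[0,S] \<times> [0,S]\<close> are unique;
  the choice only affects values outside this square.
\<close>

definition green :: "bc \<Rightarrow> (real \<Rightarrow> real) \<Rightarrow> real \<Rightarrow> real \<Rightarrow> real \<Rightarrow> real" where
  "green B q S = (SOME G. is_green B q S G)"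

text \<open>Even extension from \<open>[0,T]\<close> to \<open>[0,2T]\<close>.\<close>

definition even_ext :: "real \<Rightarrow> (real \<Rightarrow> real) \<Rightarrow> real \<Rightarrow> real" where
  "even_ext T a t = (if t \<le> T then a t else a (2 * T - t))"

end

theory Submission
  imports Defs
begin

text \<open>
  The identities express the method of images.  Let \<open>\<sigma>\<close> be a source on \<open>[0,T]\<close>, extended by zero, and
  let \<open>w\<close> be the solution of the problem on \<open>[0,2T]\<close> or \<open>[0,4T]\<close>.  The extended coefficient is
  even about \<open>T\<close> (and \<open>2T\<close>), so \<open>w(2T - t)\<close>, \<open>w(4T - t)\<close> and \<open>w(2T + t)\<close> solve, as functions on
  \<open>[0,T]\<close>, the equation with coefficient \<open>a\<close>; their sources are reflected copies of the extension of
  \<open>\<sigma>\<close> and vanish on \<open>[0,T)\<close>.  The signed sum on the right hand side therefore solves the equation with source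
  \<open>\<sigma>\<close>.  The signs make it odd about \<open>T\<close> for the conditions \<open>M\<^sub>1\<close> and even about \<open>T\<close> for \<open>M\<^sub>2\<close>, which
  gives the condition at \<open>T\<close>; the one at \<open>0\<close> follows from the boundary conditions of \<open>w\<close>.
  As the mixed problem is nonresonant, the sum is its solution, and since \<open>\<sigma>\<close> is arbitrary
  and the kernels are continuous, the kernels coincide (\<open>green_function_reflection\<close>).

  The function \<open>green\<close> is a choice, so this argument is available only once a Green's function is
  known to exist in the nonresonant case (\<open>green_function_exists\<close>).  For a coefficient in \<open>L\<^sup>1\<close>, solutions come
  from the equivalent Volterra equation, solved by a contraction in an exponentially weighted sup norm
  simultaneously for all values of a parameter (\<open>volterra_solution_exists\<close>).  That its solutions lie in
  \<open>W\<^sup>2\<^sup>,\<^sup>1\<close> and satisfy the equation almost everywhere (\<open>volterra_imp_ode_solution\<close>) rests on two facts about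
  indefinite integrals: they are absolutely continuous (\<open>abs_cont_on_indefinite_integral\<close>) and almost everywhere
  differentiable with the expected derivative (\<open>indefinite_integral_has_derivative_ae\<close>).  Fubini's
  theorem passes from the parametrised solutions to solutions for arbitrary sources, and a pair
  of linear equations, solvable by nonresonance, adjusts the boundary values.
\<close>

section \<open>Lebesgue's differentiation theorem on an interval\<close>

text \<open>
  Every point of the exceptional set is an end point of arbitrarily short intervals, fine for a
  Henstock gauge, on which the Riemann term misses the integral by more than \<open>e\<close> times the length.
  Vitali's theorem selects disjoint ones that cover almost all of the set; they form a tagged partial
  division, so Henstock's lemma makes the sum of the errors smaller than \<open>e * \<eta>\<close>, whence the
  total length is at most \<open>\<eta>\<close>.
\<close>
lemma negligible_large_quotient:
  fixes f :: "real \<Rightarrow> real"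
  assumes f: "f integrable_on {a..b}" and e: "e > 0"
  defines "F \<equiv> \<lambda>u. integral {a..u} f"
  shows "negligible {x\<in>{a..b}. \<forall>d>0. \<exists>y\<in>{a..b}. \<bar>y - x\<bar> < d \<and> e * \<bar>y - x\<bar> < \<bar>F y - F x - f x * (y - x)\<bar>}"
    (is "negligible ?E")
  unfolding negligible_outer_le
proof (intro allI impI)
  fix \<eta> :: real assume "\<eta> > 0"
  with e have "e * \<eta> > 0" by simp
  then obtain \<gamma> where \<gamma>: "gauge \<gamma>"
    and small: "\<And>p. \<lbrakk>p tagged_partial_division_of (cbox a b); \<gamma> fine p\<rbrakk> \<Longrightarrow>
             (\<Sum>(x,k)\<in>p. norm (Henstock_Kurzweil_Integration.content k *\<^sub>R f x - integral k f)) < e * \<eta>"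
    using Henstock_lemma[of f a b "e * \<eta>"] f by (auto simp: box_real)
  define J where "J = (\<lambda>(x::real,y). {min x y..max x y})"
  define c where "c = (\<lambda>(x::real,y). (x + y) / 2)"
  define r where "r = (\<lambda>(x::real,y). \<bar>y - x\<bar> / 2)"
  define K where "K = {(x,y). x \<in> {a..b} \<and> y \<in> {a..b} \<and> J (x,y) \<subseteq> \<gamma> x \<and>
                         e * \<bar>y - x\<bar> < \<bar>F y - F x - f x * (y - x)\<bar>}"
  have Jc: "cball (c i) (r i) = J i" for i
    by (cases i) (auto simp: J_def c_def r_def cball_eq_atLeastAtMost min_def max_def field_simps abs_if)
  have K_ne: "x \<noteq> y" if "(x,y) \<in> K" for x y
    using that by (auto simp: K_def)
  obtain C where C: "countable C" "C \<subseteq> K"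
     "pairwise (\<lambda>i j. disjnt (J i) (J j)) C" "negligible (?E - (\<Union>i \<in> C. J i))"
  proof (rule Vitali_covering_theorem_cballs[of K r ?E c])
    show "0 < r i" if "i \<in> K" for i
      using that K_ne by (cases i) (force simp: r_def)
    show "\<exists>i. i \<in> K \<and> x \<in> cball (c i) (r i) \<and> r i < d" if x: "x \<in> ?E" and "0 < d" for x d
    proof -
      have "open (\<gamma> x)" "x \<in> \<gamma> x"
        using \<gamma> by (auto simp: gauge_def)
      then obtain d' where d': "d' > 0" "ball x d' \<subseteq> \<gamma> x"
        using open_contains_ball by blast
      from x \<open>0 < d\<close> d' obtain y where y: "y \<in> {a..b}" "\<bar>y - x\<bar> < min d d'"
          "e * \<bar>y - x\<bar> < \<bar>F y - F x - f x * (y - x)\<bar>"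
        by (auto dest: spec[of _ "min d d'"])
      have "J (x,y) \<subseteq> ball x d'"
        using y by (auto simp: J_def dist_real_def)
      then have "(x,y) \<in> K"
        using y x d' by (auto simp: K_def)
      moreover have "x \<in> cball (c (x,y)) (r (x,y))"
        unfolding Jc by (auto simp: J_def)
      moreover have "r (x,y) < d"
        using y by (auto simp: r_def)
      ultimately show ?thesis by blast
    qed
  qed (auto simp: Jc)
  have bound: "measure lebesgue (\<Union>i\<in>I. J i) \<le> \<eta>" if I: "I \<subseteq> C" "finite I" for I
  proof -
    define p where "p = (\<lambda>i. (fst i, J i)) ` I"
    have disj: "J i \<inter> J j = {}" if "i \<in> I" "j \<in> I" "i \<noteq> j" for i j
      using C(3) I that by (auto simp: pairwise_def disjnt_def)
    have Jne: "J i \<noteq> {}" for i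
      by (cases i) (auto simp: J_def)
    have inj: "inj_on (\<lambda>i. (fst i, J i)) I"
    proof (rule inj_onI)
      fix i j assume "i \<in> I" "j \<in> I" "(fst i, J i) = (fst j, J j)"
      then show "i = j" using disj[of i j] Jne[of i] by auto
    qed
    have IK: "I \<subseteq> K" using I C by auto
    have "p tagged_partial_division_of (cbox a b)"
      unfolding tagged_partial_division_of_def
    proof (intro conjI allI impI)
      show "finite p" using I by (simp add: p_def)
    next
      fix x k assume "(x, k) \<in> p"
      then obtain y where xy: "(x,y) \<in> I" and k: "k = J (x,y)"
        by (auto simp: p_def)
      then have "(x,y) \<in> K" using IK by auto
      then show "k \<subseteq> cbox a b"
        unfolding k by (auto simp: K_def J_def)
      show "x \<in> k"
        by (simp add: k J_def)
      have "k = cbox (min x y) (max x y)"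
        by (simp add: k J_def)
      then show "\<exists>a b. k = cbox a b" by blast
    next
      fix x1 k1 x2 k2 assume A: "(x1, k1) \<in> p \<and> (x2, k2) \<in> p \<and> (x1, k1) \<noteq> (x2, k2)"
      then obtain i j where "i \<in> I" "j \<in> I" "x1 = fst i" "k1 = J i" "x2 = fst j" "k2 = J j"
        unfolding p_def by blast
      then have "k1 \<inter> k2 = {}"
        using A disj[of i j] by fastforce
      then show "interior k1 \<inter> interior k2 = {}"
        using interior_subset by blast
    qed
    moreover have "\<gamma> fine p"
    proof -
      have "J i \<subseteq> \<gamma> (fst i)" if "i \<in> I" for i
        using subsetD[OF IK that] by (cases i) (simp add: K_def)
      then show ?thesis by (fastforce simp: fine_def p_def)
    qed
    ultimately have "(\<Sum>(x,k)\<in>p. norm (Henstock_Kurzweil_Integration.content k *\<^sub>R f x - integral k f)) < e * \<eta>"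
      by (rule small)
    also have "(\<Sum>(x,k)\<in>p. norm (Henstock_Kurzweil_Integration.content k *\<^sub>R f x - integral k f)) =
               (\<Sum>i\<in>I. norm (Henstock_Kurzweil_Integration.content (J i) *\<^sub>R f (fst i) - integral (J i) f))"
      unfolding p_def by (simp add: sum.reindex[OF inj] o_def)
    finally have *: "(\<Sum>i\<in>I. norm (Henstock_Kurzweil_Integration.content (J i) *\<^sub>R f (fst i) - integral (J i) f)) < e * \<eta>" .
    have "e * measure lebesgue (J i) \<le> norm (Henstock_Kurzweil_Integration.content (J i) *\<^sub>R f (fst i) - integral (J i) f)" if "i \<in> I" for i
    proof -
      obtain x y where i: "i = (x,y)" by (cases i)
      with that IK have xy: "x \<in> {a..b}" "y \<in> {a..b}"
        "e * \<bar>y - x\<bar> < \<bar>F y - F x - f x * (y - x)\<bar>"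
        by (auto simp: K_def)
      have comb: "integral {u..v} f = F v - F u" if "a \<le> u" "u \<le> v" "v \<le> b" for u v
        using that Henstock_Kurzweil_Integration.integral_combine[where a=a and c=u and b=v and f=f] integrable_subinterval_real[OF f, of a v]
        by (auto simp: F_def)
      show ?thesis
      proof (cases "x \<le> y")
        case True
        then show ?thesis
          using xy comb[of x y] by (simp add: i J_def abs_minus_commute algebra_simps)
      next
        case False
        then show ?thesis
          using xy comb[of y x] by (simp add: i J_def abs_minus_commute algebra_simps)
      qed
    qed
    then have "(\<Sum>i\<in>I. e * measure lebesgue (J i)) \<le> e * \<eta>"
      using * by (intro order_trans[OF sum_mono less_imp_le])
    then have "(\<Sum>i\<in>I. measure lebesgue (J i)) \<le> \<eta>"
      using e by (simp flip: sum_distrib_left)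
    moreover have "measure lebesgue (\<Union>i\<in>I. J i) \<le> (\<Sum>i\<in>I. measure lebesgue (J i))"
      using I by (intro measure_UNION_le) (auto simp: J_def)
    ultimately show ?thesis by simp
  qed
  have meas: "J i \<in> lmeasurable" for i
    by (cases i) (auto simp: J_def)
  have U: "(\<Union>i\<in>C. J i) \<in> lmeasurable" "measure lebesgue (\<Union>i\<in>C. J i) \<le> \<eta>"
  proof -
    have "measure lebesgue (\<Union>i\<in>I. J i) \<le> \<eta>" if "I \<subseteq> C" "finite I" for I
      using that by (rule bound)
    then show "(\<Union>i\<in>C. J i) \<in> lmeasurable"
      by (rule fmeasurable_UN_bound[OF C(1) meas])
    have "measure lebesgue (\<Union>i\<in>I. J i) \<le> \<eta>" if "I \<subseteq> C" "finite I" for I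
      using that by (rule bound)
    then show "measure lebesgue (\<Union>i\<in>C. J i) \<le> \<eta>"
      by (rule measure_UN_bound[OF C(1) meas])
  qed
  let ?T = "(\<Union>i\<in>C. J i) \<union> (?E - (\<Union>i\<in>C. J i))"
  show "\<exists>T. ?E \<subseteq> T \<and> T \<in> lmeasurable \<and> measure lebesgue T \<le> \<eta>"
  proof (intro exI conjI)
    show "?T \<in> lmeasurable"
      using C(4) by (intro fmeasurable.Un[OF U(1)] negligible_imp_measurable)
    show "measure lebesgue ?T \<le> \<eta>"
      using U(2) measure_Un_null_set[OF fmeasurableD[OF U(1)] C(4)[unfolded negligible_iff_null_sets]] by simp
  qed auto
qed

theorem indefinite_integral_has_derivative_ae:
  fixes f :: "real \<Rightarrow> real"
  assumes f: "f integrable_on {a..b}"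
  shows "AE x in lebesgue. x \<in> {a..b} \<longrightarrow>
           ((\<lambda>u. integral {a..u} f) has_real_derivative f x) (at x within {a..b})"
proof -
  define F where "F = (\<lambda>u. integral {a..u} f)"
  define E where "E = (\<lambda>n. {x\<in>{a..b}. \<forall>d>0. \<exists>y\<in>{a..b}. \<bar>y - x\<bar> < d \<and>
                        inverse (real (Suc n)) * \<bar>y - x\<bar> < \<bar>F y - F x - f x * (y - x)\<bar>})"
  have "negligible (E n)" for n
    unfolding E_def F_def by (rule negligible_large_quotient[OF f]) simp
  then have "negligible (\<Union>n. E n)"
    by (intro negligible_countable_Union) auto
  then have "AE x in lebesgue. x \<notin> (\<Union>n. E n)"
    by (metis AE_not_in negligible_iff_null_sets)
  then show ?thesis
  proof eventually_elim
    fix x assume x: "x \<notin> (\<Union>n. E n)"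
    show "x \<in> {a..b} \<longrightarrow> ((\<lambda>u. integral {a..u} f) has_real_derivative f x) (at x within {a..b})"
      unfolding has_field_derivative_def has_derivative_within_alt F_def[symmetric]
    proof (intro impI conjI allI bounded_linear_mult_right)
      fix e :: real assume "0 < e" and xab: "x \<in> {a..b}"
      obtain n where n: "inverse (real (Suc n)) < e"
        using reals_Archimedean[OF \<open>0 < e\<close>] by blast
      have "x \<notin> E n" using x by blast
      with xab have "\<exists>d>0. \<forall>y\<in>{a..b}. \<bar>y - x\<bar> < d \<longrightarrow>
           \<not> inverse (real (Suc n)) * \<bar>y - x\<bar> < \<bar>F y - F x - f x * (y - x)\<bar>"
        unfolding E_def mem_Collect_eq by blast
      then obtain d where "d > 0" and d: "\<And>y. y \<in> {a..b} \<Longrightarrow> \<bar>y - x\<bar> < d \<Longrightarrow>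
           \<bar>F y - F x - f x * (y - x)\<bar> \<le> inverse (real (Suc n)) * \<bar>y - x\<bar>"
        unfolding not_less by blast
      have "norm (F y - F x - f x * (y - x)) \<le> e * norm (y - x)"
        if "y \<in> {a..b}" "norm (y - x) < d" for y
        using order_trans[OF d[OF that(1)] mult_right_mono[OF less_imp_le[OF n]]] that by auto
      then show "\<exists>d>0. \<forall>y\<in>{a..b}. norm (y - x) < d \<longrightarrow> norm (F y - F x - f x * (y - x)) \<le> e * norm (y - x)"
        using \<open>d > 0\<close> by blast
    qed
  qed
qed

section \<open>Absolute continuity\<close>

definition short_family :: "real \<Rightarrow> real \<Rightarrow> real \<Rightarrow> nat \<Rightarrow> (nat \<Rightarrow> real) \<Rightarrow> (nat \<Rightarrow> real) \<Rightarrow> bool" where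
  "short_family c d \<delta> n \<alpha> \<beta> \<longleftrightarrow>
     (\<forall>i<n. c \<le> \<alpha> i \<and> \<alpha> i \<le> \<beta> i \<and> \<beta> i \<le> d) \<and>
     disjoint_family_on (\<lambda>i. {\<alpha> i<..<\<beta> i}) {..<n} \<and> (\<Sum>i<n. \<beta> i - \<alpha> i) < \<delta>"

lemma abs_cont_onI:
  assumes "\<And>\<epsilon>. \<epsilon> > 0 \<Longrightarrow> \<exists>\<delta>>0. \<forall>n \<alpha> \<beta>. short_family c d \<delta> n \<alpha> \<beta> \<longrightarrow> (\<Sum>i<n. \<bar>f (\<beta> i) - f (\<alpha> i)\<bar>) < \<epsilon>"
  shows "abs_cont_on c d f"
  using assms unfolding abs_cont_on_def short_family_def by blast

lemma abs_cont_onE: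
  assumes "abs_cont_on c d f" "\<epsilon> > 0"
  obtains \<delta> where "\<delta> > 0"
    "\<And>n \<alpha> \<beta>. short_family c d \<delta> n \<alpha> \<beta> \<Longrightarrow> (\<Sum>i<n. \<bar>f (\<beta> i) - f (\<alpha> i)\<bar>) < \<epsilon>"
  using assms unfolding abs_cont_on_def short_family_def by blast

lemma sum_integral_disjoint_le:
  fixes g :: "real \<Rightarrow> real"
  assumes g: "g integrable_on {a..b}" and nonneg: "\<And>x. 0 \<le> g x" and "finite I"
    and \<alpha>\<beta>: "\<And>i. i \<in> I \<Longrightarrow> a \<le> \<alpha> i \<and> \<alpha> i \<le> \<beta> i \<and> \<beta> i \<le> b"
    and disj: "disjoint_family_on (\<lambda>i. {\<alpha> i<..<\<beta> i}) I"
  shows "(\<Sum>i\<in>I. integral {\<alpha> i..\<beta> i} g) \<le> integral {a..b} g"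
proof -
  have gi: "g integrable_on {\<alpha> i..\<beta> i}" if "i \<in> I" for i
    using integrable_subinterval_real[OF g, of "\<alpha> i" "\<beta> i"] \<alpha>\<beta>[OF that] by auto
  have "(g has_integral (\<Sum>i\<in>I. integral {\<alpha> i..\<beta> i} g)) (\<Union>i\<in>I. {\<alpha> i<..<\<beta> i})"
  proof (rule has_integral_UN[OF \<open>finite I\<close>])
    show "(g has_integral integral {\<alpha> i..\<beta> i} g) {\<alpha> i<..<\<beta> i}" if "i \<in> I" for i
      using gi[OF that] by (simp add: has_integral_Icc_iff_Ioo[symmetric] integrable_integral)
    show "pairwise (\<lambda>i i'. negligible ({\<alpha> i<..<\<beta> i} \<inter> {\<alpha> i'<..<\<beta> i'})) I"
      using disj by (simp add: pairwise_def disjoint_family_on_def)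
  qed
  moreover have "(\<Union>i\<in>I. {\<alpha> i<..<\<beta> i}) \<subseteq> {a..b}"
    using \<alpha>\<beta> by force
  ultimately show ?thesis
    using integral_subset_le[of "\<Union>i\<in>I. {\<alpha> i<..<\<beta> i}" "{a..b}" g] g nonneg
    by (auto simp: has_integral_iff)
qed

text \<open>
  Truncating \<open>\<bar>f\<bar>\<close> at a height \<open>n\<close> leaves a remainder of small integral (dominated convergence),
  while the truncated part contributes at most \<open>n\<close> times the total length of the intervals.
\<close>
lemma abs_cont_on_indefinite_integral:
  fixes f :: "real \<Rightarrow> real"
  assumes f: "f absolutely_integrable_on {a..b}"
  shows "abs_cont_on a b (\<lambda>t. integral {a..t} f)"
proof (rule abs_cont_onI)
  fix \<epsilon> :: real assume "\<epsilon> > 0"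
  define m where "m = (\<lambda>(n::nat) x. min \<bar>f x\<bar> (real n))"
  define g where "g = (\<lambda>n x. \<bar>f x\<bar> - m n x)"
  have fn: "(\<lambda>x. \<bar>f x\<bar>) absolutely_integrable_on {a..b}"
    using absolutely_integrable_norm[OF f] by (simp add: o_def)
  have m: "m n absolutely_integrable_on {a..b}" for n
    unfolding m_def using fn by (intro absolutely_integrable_min_1 absolutely_integrable_on_const) auto
  have gi: "g n integrable_on {a..b}" for n
    unfolding g_def using fn m by (intro integrable_diff) (auto simp: absolutely_integrable_on_def)
  have "(\<lambda>n. integral {a..b} (g n)) \<longlonglongrightarrow> integral {a..b} (\<lambda>x. 0)"
  proof (rule dominated_convergence(2)[OF gi])
    show "(\<lambda>x. \<bar>f x\<bar>) integrable_on {a..b}"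
      using fn by (simp add: absolutely_integrable_on_def)
    show "(\<lambda>n. g n x) \<longlonglongrightarrow> 0" for x
    proof (rule tendsto_eventually)
      obtain N where "\<bar>f x\<bar> \<le> real N" using real_arch_simple by blast
      then show "\<forall>\<^sub>F n in sequentially. g n x = 0"
        by (auto intro!: eventually_sequentiallyI[of N] simp: g_def m_def)
    qed
  qed (auto simp: g_def m_def)
  then have "\<forall>\<^sub>F n in sequentially. integral {a..b} (g n) < \<epsilon> / 2"
    using \<open>\<epsilon> > 0\<close> by (intro order_tendstoD(2)) auto
  then obtain n where n: "integral {a..b} (g n) < \<epsilon> / 2"
    using eventually_happens'[OF sequentially_bot] by blast
  \<comment> \<open>The remainder takes one half of \<open>\<epsilon>\<close>, the truncated part \<open>real n * \<delta>\<close> less than the other.\<close>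
  define \<delta> where "\<delta> = \<epsilon> / (2 * (real n + 1))"
  show "\<exists>\<delta>>0. \<forall>k \<alpha> \<beta>. short_family a b \<delta> k \<alpha> \<beta> \<longrightarrow>
          (\<Sum>i<k. \<bar>integral {a..\<beta> i} f - integral {a..\<alpha> i} f\<bar>) < \<epsilon>"
  proof (intro exI[of _ \<delta>] conjI allI impI)
    show "\<delta> > 0" using \<open>\<epsilon> > 0\<close> by (simp add: \<delta>_def)
  next
    fix k :: nat and \<alpha> \<beta> :: "nat \<Rightarrow> real"
    assume "short_family a b \<delta> k \<alpha> \<beta>"
    then have A: "(\<forall>i<k. a \<le> \<alpha> i \<and> \<alpha> i \<le> \<beta> i \<and> \<beta> i \<le> b) \<and>
        disjoint_family_on (\<lambda>i. {\<alpha> i<..<\<beta> i}) {..<k} \<and> (\<Sum>i<k. \<beta> i - \<alpha> i) < \<delta>"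
      unfolding short_family_def .
    have each: "\<bar>integral {a..\<beta> i} f - integral {a..\<alpha> i} f\<bar>
                  \<le> integral {\<alpha> i..\<beta> i} (g n) + real n * (\<beta> i - \<alpha> i)" if "i < k" for i
    proof -
      have le: "a \<le> \<alpha> i" "\<alpha> i \<le> \<beta> i" "\<beta> i \<le> b" using A that by auto
      have sub: "{\<alpha> i..\<beta> i} \<subseteq> {a..b}" "{a..\<beta> i} \<subseteq> {a..b}" using le by auto
      have fi: "f integrable_on {a..b}" using f by (simp add: absolutely_integrable_on_def)
      have "integral {a..\<beta> i} f - integral {a..\<alpha> i} f = integral {\<alpha> i..\<beta> i} f"
        using Henstock_Kurzweil_Integration.integral_combine[where a=a and c="\<alpha> i" and b="\<beta> i" and f=f] le integrable_subinterval_real[OF fi sub(2)] by simp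
      moreover have "\<bar>integral {\<alpha> i..\<beta> i} f\<bar> \<le> integral {\<alpha> i..\<beta> i} (\<lambda>x. g n x + real n)"
      proof -
        have "norm (integral {\<alpha> i..\<beta> i} f) \<le> integral {\<alpha> i..\<beta> i} (\<lambda>x. g n x + real n)"
          by (rule integral_norm_bound_integral)
             (use fi gi[of n] sub in \<open>auto simp: g_def m_def intro!: integrable_add intro: integrable_subinterval_real\<close>)
        then show ?thesis by simp
      qed
      moreover have "integral {\<alpha> i..\<beta> i} (\<lambda>x. g n x + real n) = integral {\<alpha> i..\<beta> i} (g n) + real n * (\<beta> i - \<alpha> i)"
        using integrable_subinterval_real[OF gi sub(1)] le by (subst integral_add) (auto simp: mult.commute)
      ultimately show ?thesis by simp
    qed
    have "(\<Sum>i<k. \<bar>integral {a..\<beta> i} f - integral {a..\<alpha> i} f\<bar>)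
            \<le> (\<Sum>i<k. integral {\<alpha> i..\<beta> i} (g n) + real n * (\<beta> i - \<alpha> i))"
      using each by (intro sum_mono) auto
    also have "\<dots> = (\<Sum>i<k. integral {\<alpha> i..\<beta> i} (g n)) + real n * (\<Sum>i<k. \<beta> i - \<alpha> i)"
      by (simp add: sum.distrib sum_distrib_left)
    also have "\<dots> \<le> integral {a..b} (g n) + real n * \<delta>"
    proof (intro add_mono mult_left_mono)
      show "(\<Sum>i<k. integral {\<alpha> i..\<beta> i} (g n)) \<le> integral {a..b} (g n)"
        using A by (intro sum_integral_disjoint_le gi) (auto simp: g_def m_def)
    qed (use A in auto)
    also have "\<dots> < \<epsilon>"
    proof -
      have "real n * \<delta> < \<epsilon> / 2"
        using \<open>\<epsilon> > 0\<close> by (simp add: \<delta>_def field_simps)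
      with n show ?thesis by simp
    qed
    finally show "(\<Sum>i<k. \<bar>integral {a..\<beta> i} f - integral {a..\<alpha> i} f\<bar>) < \<epsilon>" .
  qed
qed

lemma abs_cont_on_cong:
  assumes f: "abs_cont_on c d f" and eq: "\<And>t. t \<in> {c..d} \<Longrightarrow> g t = f t"
  shows "abs_cont_on c d g"
proof (rule abs_cont_onI)
  fix \<epsilon> :: real assume "\<epsilon> > 0"
  then obtain \<delta> where "\<delta> > 0"
    and \<delta>: "\<And>n \<alpha> \<beta>. short_family c d \<delta> n \<alpha> \<beta> \<Longrightarrow> (\<Sum>i<n. \<bar>f (\<beta> i) - f (\<alpha> i)\<bar>) < \<epsilon>"
    using abs_cont_onE[OF f] by blast
  have "(\<Sum>i<n. \<bar>g (\<beta> i) - g (\<alpha> i)\<bar>) < \<epsilon>" if A: "short_family c d \<delta> n \<alpha> \<beta>" for n \<alpha> \<beta>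
  proof -
    have "(\<Sum>i<n. \<bar>g (\<beta> i) - g (\<alpha> i)\<bar>) = (\<Sum>i<n. \<bar>f (\<beta> i) - f (\<alpha> i)\<bar>)"
      using A eq unfolding short_family_def by (intro sum.cong refl) force
    then show ?thesis
      using \<delta>[OF A] by simp
  qed
  then show "\<exists>\<delta>>0. \<forall>n \<alpha> \<beta>. short_family c d \<delta> n \<alpha> \<beta> \<longrightarrow> (\<Sum>i<n. \<bar>g (\<beta> i) - g (\<alpha> i)\<bar>) < \<epsilon>"
    using \<open>\<delta> > 0\<close> by blast
qed

lemma abs_cont_on_add:
  assumes f: "abs_cont_on c d f" and g: "abs_cont_on c d g"
  shows "abs_cont_on c d (\<lambda>t. f t + g t)"
proof (rule abs_cont_onI)
  fix \<epsilon> :: real assume "\<epsilon> > 0"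
  then have e2: "\<epsilon> / 2 > 0" by simp
  obtain \<delta>1 where "\<delta>1 > 0"
    and \<delta>1: "\<And>n \<alpha> \<beta>. short_family c d \<delta>1 n \<alpha> \<beta> \<Longrightarrow> (\<Sum>i<n. \<bar>f (\<beta> i) - f (\<alpha> i)\<bar>) < \<epsilon> / 2"
    using abs_cont_onE[OF f e2] by blast
  obtain \<delta>2 where "\<delta>2 > 0"
    and \<delta>2: "\<And>n \<alpha> \<beta>. short_family c d \<delta>2 n \<alpha> \<beta> \<Longrightarrow> (\<Sum>i<n. \<bar>g (\<beta> i) - g (\<alpha> i)\<bar>) < \<epsilon> / 2"
    using abs_cont_onE[OF g e2] by blast
  have "(\<Sum>i<n. \<bar>f (\<beta> i) + g (\<beta> i) - (f (\<alpha> i) + g (\<alpha> i))\<bar>) < \<epsilon>"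
    if A: "short_family c d (min \<delta>1 \<delta>2) n \<alpha> \<beta>" for n \<alpha> \<beta>
  proof -
    have A12: "short_family c d \<delta>1 n \<alpha> \<beta>" "short_family c d \<delta>2 n \<alpha> \<beta>"
      using A by (simp_all add: short_family_def)
    have "(\<Sum>i<n. \<bar>f (\<beta> i) + g (\<beta> i) - (f (\<alpha> i) + g (\<alpha> i))\<bar>)
            \<le> (\<Sum>i<n. \<bar>f (\<beta> i) - f (\<alpha> i)\<bar> + \<bar>g (\<beta> i) - g (\<alpha> i)\<bar>)"
      by (intro sum_mono) linarith
    also have "\<dots> = (\<Sum>i<n. \<bar>f (\<beta> i) - f (\<alpha> i)\<bar>) + (\<Sum>i<n. \<bar>g (\<beta> i) - g (\<alpha> i)\<bar>)"
      by (rule sum.distrib)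
    also have "\<dots> < \<epsilon>"
      using \<delta>1[OF A12(1)] \<delta>2[OF A12(2)] by simp
    finally show ?thesis .
  qed
  then show "\<exists>\<delta>>0. \<forall>n \<alpha> \<beta>. short_family c d \<delta> n \<alpha> \<beta> \<longrightarrow>
               (\<Sum>i<n. \<bar>f (\<beta> i) + g (\<beta> i) - (f (\<alpha> i) + g (\<alpha> i))\<bar>) < \<epsilon>"
    using \<open>\<delta>1 > 0\<close> \<open>\<delta>2 > 0\<close> by (intro exI[of _ "min \<delta>1 \<delta>2"]) simp
qed

lemma abs_cont_on_cmult:
  assumes f: "abs_cont_on c d f"
  shows "abs_cont_on c d (\<lambda>t. k * f t)"
proof (rule abs_cont_onI)
  fix \<epsilon> :: real assume "\<epsilon> > 0"
  then have "\<epsilon> / (\<bar>k\<bar> + 1) > 0" by simp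
  then obtain \<delta> where "\<delta> > 0" and \<delta>: "\<And>n \<alpha> \<beta>. short_family c d \<delta> n \<alpha> \<beta> \<Longrightarrow>
      (\<Sum>i<n. \<bar>f (\<beta> i) - f (\<alpha> i)\<bar>) < \<epsilon> / (\<bar>k\<bar> + 1)"
    using abs_cont_onE[OF f] by blast
  have "(\<Sum>i<n. \<bar>k * f (\<beta> i) - k * f (\<alpha> i)\<bar>) < \<epsilon>" if A: "short_family c d \<delta> n \<alpha> \<beta>" for n \<alpha> \<beta>
  proof -
    let ?X = "\<Sum>i<n. \<bar>f (\<beta> i) - f (\<alpha> i)\<bar>"
    have "(\<Sum>i<n. \<bar>k * f (\<beta> i) - k * f (\<alpha> i)\<bar>) = \<bar>k\<bar> * ?X"
      by (simp add: sum_distrib_left abs_mult flip: right_diff_distrib)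
    also have "\<dots> \<le> (\<bar>k\<bar> + 1) * ?X"
      by (intro mult_right_mono sum_nonneg) auto
    also have "\<dots> < \<epsilon>"
      using \<delta>[OF A] by (simp add: pos_less_divide_eq mult.commute)
    finally show ?thesis .
  qed
  then show "\<exists>\<delta>>0. \<forall>n \<alpha> \<beta>. short_family c d \<delta> n \<alpha> \<beta> \<longrightarrow> (\<Sum>i<n. \<bar>k * f (\<beta> i) - k * f (\<alpha> i)\<bar>) < \<epsilon>"
    using \<open>\<delta> > 0\<close> by blast
qed

lemma abs_cont_on_affine:
  assumes f: "abs_cont_on c d f" and e: "e = 1 \<or> e = -1"
    and maps: "\<And>t. t \<in> {x..y} \<Longrightarrow> p + e * t \<in> {c..d}"
  shows "abs_cont_on x y (\<lambda>t. f (p + e * t))"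
proof (rule abs_cont_onI)
  fix \<epsilon> :: real assume "\<epsilon> > 0"
  then obtain \<delta> where "\<delta> > 0"
    and \<delta>: "\<And>n \<alpha> \<beta>. short_family c d \<delta> n \<alpha> \<beta> \<Longrightarrow> (\<Sum>i<n. \<bar>f (\<beta> i) - f (\<alpha> i)\<bar>) < \<epsilon>"
    using abs_cont_onE[OF f] by blast
  have "(\<Sum>i<n. \<bar>f (p + e * \<beta> i) - f (p + e * \<alpha> i)\<bar>) < \<epsilon>" if A: "short_family x y \<delta> n \<alpha> \<beta>" for n \<alpha> \<beta>
  proof -
    \<comment> \<open>For \<open>e = -1\<close> the image of \<open>[\<alpha> i, \<beta> i]\<close> has its end points exchanged.\<close>
    define \<alpha>' where "\<alpha>' = (\<lambda>i. min (p + e * \<alpha> i) (p + e * \<beta> i))"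
    define \<beta>' where "\<beta>' = (\<lambda>i. max (p + e * \<alpha> i) (p + e * \<beta> i))"
    have le: "x \<le> \<alpha> i" "\<alpha> i \<le> \<beta> i" "\<beta> i \<le> y" if "i < n" for i
      using A that by (auto simp: short_family_def)
    have len: "\<beta>' i - \<alpha>' i = \<beta> i - \<alpha> i" if "i < n" for i
      using le[OF that] e by (auto simp: \<alpha>'_def \<beta>'_def)
    have in_cd: "c \<le> \<alpha>' i \<and> \<alpha>' i \<le> \<beta>' i \<and> \<beta>' i \<le> d" if "i < n" for i
      using le[OF that] maps[of "\<alpha> i"] maps[of "\<beta> i"] by (auto simp: \<alpha>'_def \<beta>'_def)
    have pre: "e * (z - p) \<in> {\<alpha> i<..<\<beta> i}" if "i < n" "z \<in> {\<alpha>' i<..<\<beta>' i}" for z i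
      using that(2) le[OF that(1)] e by (auto simp: \<alpha>'_def \<beta>'_def min_def max_def split: if_splits)
    have "disjoint_family_on (\<lambda>i. {\<alpha>' i<..<\<beta>' i}) {..<n}"
      unfolding disjoint_family_on_def
    proof (intro ballI impI)
      fix i j assume ij: "i \<in> {..<n}" "j \<in> {..<n}" "i \<noteq> j"
      then have "{\<alpha> i<..<\<beta> i} \<inter> {\<alpha> j<..<\<beta> j} = {}"
        using A by (simp add: short_family_def disjoint_family_on_def)
      then show "{\<alpha>' i<..<\<beta>' i} \<inter> {\<alpha>' j<..<\<beta>' j} = {}"
        using pre[of i] pre[of j] ij by blast
    qed
    moreover have "(\<Sum>i<n. \<beta>' i - \<alpha>' i) = (\<Sum>i<n. \<beta> i - \<alpha> i)"
      by (intro sum.cong refl) (simp add: len)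
    ultimately have "short_family c d \<delta> n \<alpha>' \<beta>'"
      using A in_cd by (simp add: short_family_def)
    then have "(\<Sum>i<n. \<bar>f (\<beta>' i) - f (\<alpha>' i)\<bar>) < \<epsilon>"
      by (rule \<delta>)
    moreover have "(\<Sum>i<n. \<bar>f (\<beta>' i) - f (\<alpha>' i)\<bar>) = (\<Sum>i<n. \<bar>f (p + e * \<beta> i) - f (p + e * \<alpha> i)\<bar>)"
      by (intro sum.cong refl) (auto simp: \<alpha>'_def \<beta>'_def min_def max_def)
    ultimately show ?thesis by simp
  qed
  then show "\<exists>\<delta>>0. \<forall>n \<alpha> \<beta>. short_family x y \<delta> n \<alpha> \<beta> \<longrightarrow>
               (\<Sum>i<n. \<bar>f (p + e * \<beta> i) - f (p + e * \<alpha> i)\<bar>) < \<epsilon>"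
    using \<open>\<delta> > 0\<close> by blast
qed

lemma abs_cont_on_imp_continuous_on:
  assumes f: "abs_cont_on c d f"
  shows "continuous_on {c..d} f"
  unfolding continuous_on_iff
proof (intro ballI allI impI)
  fix x \<epsilon> :: real assume x: "x \<in> {c..d}" and "\<epsilon> > 0"
  then obtain \<delta> where "\<delta> > 0"
    and \<delta>: "\<And>n \<alpha> \<beta>. short_family c d \<delta> n \<alpha> \<beta> \<Longrightarrow> (\<Sum>i<n. \<bar>f (\<beta> i) - f (\<alpha> i)\<bar>) < \<epsilon>"
    using abs_cont_onE[OF f] by blast
  have "dist (f y) (f x) < \<epsilon>" if y: "y \<in> {c..d}" "dist y x < \<delta>" for y
    using \<delta>[of 1 "\<lambda>_. min x y" "\<lambda>_. max x y"] x y
    by (cases "x \<le> y")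
      (auto simp: short_family_def disjoint_family_on_def dist_real_def abs_minus_commute lessThan_Suc)
  then show "\<exists>\<delta>>0. \<forall>y\<in>{c..d}. dist y x < \<delta> \<longrightarrow> dist (f y) (f x) < \<epsilon>"
    using \<open>\<delta> > 0\<close> by blast
qed

section \<open>Volterra integral equations with integrable coefficients\<close>

lemma continuous_on_section:
  assumes "continuous_on (A \<times> B) (\<lambda>(t, s). k t s)"
  shows "t \<in> A \<Longrightarrow> continuous_on B (\<lambda>s. k t s)" and "s \<in> B \<Longrightarrow> continuous_on A (\<lambda>t. k t s)"
proof -
  assume t: "t \<in> A"
  have "continuous_on B (\<lambda>s. (\<lambda>(t, s). k t s) (t, s))"
    by (rule continuous_on_compose2[OF assms]) (use t in \<open>auto intro!: continuous_intros\<close>)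
  then show "continuous_on B (\<lambda>s. k t s)" by simp
next
  assume s: "s \<in> B"
  have "continuous_on A (\<lambda>t. (\<lambda>(t, s). k t s) (t, s))"
    by (rule continuous_on_compose2[OF assms]) (use s in \<open>auto intro!: continuous_intros\<close>)
  then show "continuous_on A (\<lambda>t. k t s)" by simp
qed

lemma absolutely_integrable_continuous_mult:
  fixes f q :: "real \<Rightarrow> real"
  assumes "continuous_on {a..b} f" "q absolutely_integrable_on {a..b}"
  shows "(\<lambda>x. f x * q x) absolutely_integrable_on {a..b}"
proof (rule absolutely_integrable_bounded_measurable_product_real)
  show "f \<in> borel_measurable (lebesgue_on {a..b})"
    using assms(1) by (intro continuous_imp_measurable_on_sets_lebesgue) auto
  show "bounded (f ` {a..b})"
    using assms(1) by (intro compact_imp_bounded compact_continuous_image) auto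
qed (use assms in auto)

lemma integral_continuous_mult_bound:
  fixes f q :: "real \<Rightarrow> real"
  assumes f: "continuous_on {a..b} f" and q: "q absolutely_integrable_on {a..b}"
    and B: "\<And>x. x \<in> {a..b} \<Longrightarrow> \<bar>f x\<bar> \<le> B"
  shows "\<bar>integral {a..b} (\<lambda>x. f x * q x)\<bar> \<le> B * integral {a..b} (\<lambda>x. \<bar>q x\<bar>)"
proof -
  have qn: "(\<lambda>x. \<bar>q x\<bar>) integrable_on {a..b}"
    using q by (simp add: absolutely_integrable_on_def)
  have "norm (integral {a..b} (\<lambda>x. f x * q x)) \<le> integral {a..b} (\<lambda>x. B * \<bar>q x\<bar>)"
  proof (rule integral_norm_bound_integral)
    show "(\<lambda>x. f x * q x) integrable_on {a..b}"
      using absolutely_integrable_continuous_mult[OF f q] by (simp add: absolutely_integrable_on_def)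
    show "(\<lambda>x. B * \<bar>q x\<bar>) integrable_on {a..b}"
      using integrable_on_cmult_left[OF qn, of B] by simp
    show "norm (f x * q x) \<le> B * \<bar>q x\<bar>" if "x \<in> {a..b}" for x
      using mult_right_mono[OF B[OF that], of "\<bar>q x\<bar>"] by (simp add: abs_mult)
  qed
  then show ?thesis by simp
qed

text \<open>
  On the compact interval \<open>{a..b}\<close> the kernels \<open>k p\<close> depend on \<open>p\<close> uniformly, so an
  \<open>L\<^sup>1\<close> weight suffices.
\<close>
lemma continuous_on_parametric_integral:
  fixes k :: "'p::metric_space \<Rightarrow> real \<Rightarrow> real"
  assumes k: "continuous_on (U \<times> {a..b}) (\<lambda>(p, r). k p r)" and q: "q absolutely_integrable_on {a..b}"
  shows "continuous_on U (\<lambda>p. integral {a..b} (\<lambda>r. k p r * q r))"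
proof -
  define Q where "Q = integral {a..b} (\<lambda>x. \<bar>q x\<bar>)"
  have "Q \<ge> 0"
    unfolding Q_def using q by (intro integral_nonneg) (auto simp: absolutely_integrable_on_def)
  have kr: "continuous_on {a..b} (k p)" if "p \<in> U" for p
    using continuous_on_section(1)[OF k that] .
  have ki: "(\<lambda>r. k p r * q r) integrable_on {a..b}" if "p \<in> U" for p
    using absolutely_integrable_continuous_mult[OF kr[OF that] q] by (simp add: absolutely_integrable_on_def)
  show ?thesis
    unfolding continuous_on_def
  proof (intro ballI tendstoI)
    fix p and e :: real assume p: "p \<in> U" and "e > 0"
    define e' where "e' = e / (Q + 1)"
    have "e' > 0" using \<open>e > 0\<close> \<open>Q \<ge> 0\<close> by (simp add: e'_def)
    obtain X where X: "p \<in> X" "open X"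
      and Xk: "\<forall>y\<in>X \<inter> U. \<forall>r\<in>{a..b}. dist (case (y, r) of (p, r) \<Rightarrow> k p r) (case (p, r) of (p, r) \<Rightarrow> k p r) \<le> e'"
      using continuous_on_prod_compactE[OF k _ p \<open>e' > 0\<close>] by (metis compact_Icc)
    have "dist (integral {a..b} (\<lambda>r. k y r * q r)) (integral {a..b} (\<lambda>r. k p r * q r)) < e"
      if y: "y \<in> X \<inter> U" for y
    proof -
      have yU: "y \<in> U" using y by auto
      have "integral {a..b} (\<lambda>r. k y r * q r) - integral {a..b} (\<lambda>r. k p r * q r)
              = integral {a..b} (\<lambda>r. (k y r - k p r) * q r)"
        unfolding integral_diff[OF ki[OF yU] ki[OF p], symmetric] by (simp add: algebra_simps)
      also have "\<bar>\<dots>\<bar> \<le> e' * Q"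
        unfolding Q_def
        by (rule integral_continuous_mult_bound)
           (use Xk y in \<open>auto intro!: continuous_intros kr yU p q simp: dist_real_def\<close>)
      also have "\<dots> < e"
        using \<open>e > 0\<close> \<open>Q \<ge> 0\<close> by (simp add: e'_def field_simps)
      finally show ?thesis by (simp add: dist_real_def)
    qed
    then show "\<forall>\<^sub>F x in at p within U. dist (integral {a..b} (\<lambda>r. k x r * q r)) (integral {a..b} (\<lambda>r. k p r * q r)) < e"
      using X unfolding eventually_at_topological by blast
  qed
qed

text \<open>
  The kernel of double integration from \<open>0\<close>: with it, the Volterra integrals over \<open>[0,t]\<close> become
  integrals over the fixed interval \<open>[0,S]\<close> of a jointly continuous kernel.
\<close>
definition ramp :: "real \<Rightarrow> real" where
  "ramp x = max x 0"

lemma continuous_on_ramp [continuous_intros]: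
  "continuous_on A f \<Longrightarrow> continuous_on A (\<lambda>x. ramp (f x))"
  unfolding ramp_def by (intro continuous_intros)

text \<open>
  This bound makes the weight \<open>exp (- l * t)\<close> effective even for a merely integrable
  coefficient: the factor \<open>t - r\<close> that comes from the second order of the equation supplies the small
  constant \<open>1 / l\<close>, for which a bounded coefficient would otherwise be needed.
\<close>
lemma ramp_exp_le:
  assumes "l > 0"
  shows "\<bar>ramp x * exp (- l * x)\<bar> \<le> 1 / l"
proof (cases "x \<le> 0")
  case True
  then show ?thesis using assms by (simp add: ramp_def)
next
  case False
  have "l * x \<le> exp (l * x)"
    using exp_ge_add_one_self[of "l * x"] by linarith
  then show ?thesis
    using False assms by (simp add: ramp_def exp_minus field_simps)
qed

text \<open>
  The integral form of \<open>K'' + q K = g''\<close> in the first variable, with a parameter \<open>s\<close> in the second.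
  Banach's fixed point theorem is applied to \<open>H(t,s) = exp (- l * t) * K(t,s)\<close> in the space of
  bounded continuous functions of both variables, which yields the joint continuity of \<open>K\<close>
  together with its existence.
\<close>
theorem volterra_solution_exists:
  fixes q :: "real \<Rightarrow> real" and g :: "real \<Rightarrow> real \<Rightarrow> real"
  assumes S: "S > 0" and q: "q absolutely_integrable_on {0..S}"
    and g: "continuous_on UNIV (\<lambda>(t, s). g t s)"
  obtains K where "continuous_on UNIV (\<lambda>(t, s). K t s)"
    and "\<And>t s. t \<in> {0..S} \<Longrightarrow> s \<in> {0..S} \<Longrightarrow>
           K t s = g t s - integral {0..S} (\<lambda>r. ramp (t - r) * (q r * K r s))"
proof -
  define Q where "Q = integral {0..S} (\<lambda>x. \<bar>q x\<bar>)"
  have "Q \<ge> 0"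
    unfolding Q_def using q by (intro integral_nonneg) (auto simp: absolutely_integrable_on_def)
  \<comment> \<open>Any \<open>l \<ge> 2 * Q\<close> with \<open>l > 0\<close> makes the contraction constant \<open>Q / l\<close> at most \<open>1 / 2\<close>.\<close>
  define l where "l = 2 * (Q + 1)"
  have "l > 0" using \<open>Q \<ge> 0\<close> by (simp add: l_def)
  \<comment> \<open>Clamping to \<open>[0,S]\<close> turns data on the square into bounded continuous functions on the plane.\<close>
  define c where "c = (\<lambda>x. max 0 (min S x))"
  have c_in: "c x \<in> {0..S}" for x using S by (auto simp: c_def)
  have c_id: "c x = x" if "x \<in> {0..S}" for x using that by (auto simp: c_def)
  have c_cont [continuous_intros]: "continuous_on A f \<Longrightarrow> continuous_on A (\<lambda>x. c (f x))"
    for A and f :: "real \<times> real \<Rightarrow> real"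
    unfolding c_def by (intro continuous_intros)
  define w where "w = (\<lambda>x. ramp x * exp (- l * x))"
  have w_le: "\<bar>w x\<bar> \<le> 1 / l" for x
    unfolding w_def by (rule ramp_exp_le[OF \<open>l > 0\<close>])
  define \<Phi> where "\<Phi> = (\<lambda>H ts. exp (- l * c (fst ts)) * g (c (fst ts)) (c (snd ts))
       - integral {0..S} (\<lambda>r. w (c (fst ts) - r) * apply_bcontfun H (r, c (snd ts)) * q r))"
  have H_cont [continuous_intros]: "continuous_on A f \<Longrightarrow> continuous_on A (\<lambda>x. apply_bcontfun H (f x))"
    for A and f :: "'z::topological_space \<Rightarrow> real \<times> real" and H :: "(real \<times> real) \<Rightarrow>\<^sub>C real"
    by (rule continuous_on_compose2[of UNIV "apply_bcontfun H"]) auto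
  have g_cont: "continuous_on A (\<lambda>ts. g (c (fst ts)) (c (snd ts)))" for A
  proof -
    have "continuous_on A (\<lambda>ts. (\<lambda>(t, s). g t s) (c (fst ts), c (snd ts)))"
      by (rule continuous_on_compose2[OF g]) (auto intro!: continuous_intros)
    then show ?thesis by simp
  qed
  have int_cont: "continuous_on {0..S} (\<lambda>r. w (c t - r) * apply_bcontfun H (r, c s))" for t s and H :: "(real \<times> real) \<Rightarrow>\<^sub>C real"
    unfolding w_def by (intro continuous_intros)
  have \<Phi>_cont: "continuous_on UNIV (\<Phi> H)" for H :: "(real \<times> real) \<Rightarrow>\<^sub>C real"
  proof -
    have "continuous_on (UNIV \<times> {0..S})
            (\<lambda>(ts :: real \<times> real, r). w (c (fst ts) - r) * apply_bcontfun H (r, c (snd ts)))"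
      unfolding w_def split_def c_def by (intro continuous_intros)
    then have "continuous_on UNIV (\<lambda>ts. integral {0..S} (\<lambda>r. w (c (fst ts) - r) * apply_bcontfun H (r, c (snd ts)) * q r))"
      by (rule continuous_on_parametric_integral[OF _ q])
    then show ?thesis
      unfolding \<Phi>_def by (intro continuous_intros g_cont)
  qed
  have \<Phi>_in: "\<Phi> H \<in> bcontfun" for H
  proof -
    have "compact (\<Phi> H ` ({0..S} \<times> {0..S}))"
      by (intro compact_continuous_image continuous_on_subset[OF \<Phi>_cont] compact_Times) auto
    then obtain b where b: "\<And>p. p \<in> {0..S} \<times> {0..S} \<Longrightarrow> norm (\<Phi> H p) \<le> b"
      using compact_imp_bounded bounded_iff by (metis image_eqI)
    have "\<Phi> H ts = \<Phi> H (c (fst ts), c (snd ts))" for ts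
      using c_id[OF c_in] by (simp add: \<Phi>_def)
    then have "norm (\<Phi> H ts) \<le> b" for ts
      using b[of "(c (fst ts), c (snd ts))"] c_in by (metis mem_Times_iff fst_conv snd_conv)
    with \<Phi>_cont show ?thesis
      by (rule bcontfun_normI)
  qed
  have "\<exists>!H. Bcontfun (\<Phi> H) = H"
  proof (rule banach_fix_type[of "1/2"])
    show "\<forall>H H'. dist (Bcontfun (\<Phi> H)) (Bcontfun (\<Phi> H')) \<le> 1 / 2 * dist H H'"
    proof (intro allI dist_bound)
      fix H H' :: "(real \<times> real) \<Rightarrow>\<^sub>C real" and ts
      define t s where "t = c (fst ts)" and "s = c (snd ts)"
      have ii: "(\<lambda>r. w (t - r) * apply_bcontfun G (r, s) * q r) integrable_on {0..S}" for G
        using absolutely_integrable_continuous_mult[OF int_cont q] unfolding t_def s_def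
        by (simp add: absolutely_integrable_on_def)
      have "\<Phi> H ts - \<Phi> H' ts = - (integral {0..S} (\<lambda>r. w (t - r) * apply_bcontfun H (r, s) * q r)
              - integral {0..S} (\<lambda>r. w (t - r) * apply_bcontfun H' (r, s) * q r))"
        by (simp add: \<Phi>_def t_def s_def)
      also have "\<dots> = - integral {0..S} (\<lambda>r. (w (t - r) * (apply_bcontfun H (r, s) - apply_bcontfun H' (r, s))) * q r)"
        unfolding integral_diff[OF ii ii, symmetric] by (simp add: algebra_simps)
      also have "\<bar>\<dots>\<bar> \<le> (1 / l * dist H H') * Q"
        unfolding Q_def abs_minus_cancel
      proof (rule integral_continuous_mult_bound[OF _ q])
        show "continuous_on {0..S} (\<lambda>r. w (t - r) * (apply_bcontfun H (r, s) - apply_bcontfun H' (r, s)))"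
          unfolding w_def by (intro continuous_intros)
        show "\<bar>w (t - r) * (apply_bcontfun H (r, s) - apply_bcontfun H' (r, s))\<bar> \<le> 1 / l * dist H H'" for r
          unfolding abs_mult using w_le[of "t - r"] dist_bounded[of H "(r, s)" H'] \<open>l > 0\<close>
          by (intro mult_mono) (auto simp: dist_real_def)
      qed
      also have "\<dots> \<le> 1 / 2 * dist H H'"
      proof -
        have "Q / l \<le> 1 / 2" using \<open>Q \<ge> 0\<close> by (simp add: l_def field_simps)
        from mult_right_mono[OF this, of "dist H H'"] show ?thesis by (simp add: mult_ac)
      qed
      finally show "dist (apply_bcontfun (Bcontfun (\<Phi> H)) ts) (apply_bcontfun (Bcontfun (\<Phi> H')) ts) \<le> 1 / 2 * dist H H'"
        by (simp add: Bcontfun_inverse[OF \<Phi>_in] dist_real_def)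
    qed
  qed auto
  then obtain H where "Bcontfun (\<Phi> H) = H" by blast
  then have H: "apply_bcontfun H ts = \<Phi> H ts" for ts
    by (metis Bcontfun_inverse[OF \<Phi>_in])
  show ?thesis
  proof (rule that[of "\<lambda>t s. exp (l * t) * apply_bcontfun H (t, s)"])
    show "continuous_on UNIV (\<lambda>(t, s). exp (l * t) * apply_bcontfun H (t, s))"
      unfolding split_def by (intro continuous_intros)
  next
    fix t s assume t: "t \<in> {0..S}" and s: "s \<in> {0..S}"
    have "exp (l * t) * apply_bcontfun H (t, s) = exp (l * t) * (exp (- l * t) * g t s)
        - exp (l * t) * integral {0..S} (\<lambda>r. w (t - r) * apply_bcontfun H (r, s) * q r)"
      unfolding H[of "(t, s)"] using c_id[OF t] c_id[OF s] by (simp add: \<Phi>_def right_diff_distrib)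
    also have "exp (l * t) * (exp (- l * t) * g t s) = g t s"
      by (simp add: exp_minus)
    also have "exp (l * t) * integral {0..S} (\<lambda>r. w (t - r) * apply_bcontfun H (r, s) * q r)
        = integral {0..S} (\<lambda>r. exp (l * t) * (w (t - r) * apply_bcontfun H (r, s) * q r))"
      by (rule integral_mult_right[symmetric])
    also have "\<dots> = integral {0..S} (\<lambda>r. ramp (t - r) * (q r * (exp (l * r) * apply_bcontfun H (r, s))))"
    proof (rule integral_cong)
      fix r
      have "exp (l * t) * exp (- l * (t - r)) = exp (l * r)"
        by (simp add: algebra_simps flip: exp_add)
      then show "exp (l * t) * (w (t - r) * apply_bcontfun H (r, s) * q r)
            = ramp (t - r) * (q r * (exp (l * r) * apply_bcontfun H (r, s)))"
        unfolding w_def by (metis (no_types, lifting) mult.assoc mult.commute)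
    qed
    finally show "exp (l * t) * apply_bcontfun H (t, s)
        = g t s - integral {0..S} (\<lambda>r. ramp (t - r) * (q r * (exp (l * r) * apply_bcontfun H (r, s))))" .
  qed
qed

text \<open>
  Fubini's theorem on the square of the finite measure space \<open>lebesgue_on {a..b}\<close>; on the
  square the kernel is bounded, so the integrand is dominated by a multiple of \<open>p r * \<sigma> s\<close>.
\<close>
lemma integral_swap_continuous_kernel:
  fixes k :: "real \<Rightarrow> real \<Rightarrow> real" and p \<sigma> :: "real \<Rightarrow> real"
  assumes k: "continuous_on UNIV (\<lambda>(r, s). k r s)"
    and p: "p absolutely_integrable_on {a..b}" and \<sigma>: "\<sigma> absolutely_integrable_on {a..b}"
  shows "integral {a..b} (\<lambda>r. p r * integral {a..b} (\<lambda>s. k r s * \<sigma> s))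
       = integral {a..b} (\<lambda>s. integral {a..b} (\<lambda>r. k r s * p r) * \<sigma> s)"
proof -
  define M where "M = lebesgue_on {a..b}"
  interpret M: finite_measure M
    unfolding M_def by (rule finite_measure_lebesgue_on) simp
  interpret pair_sigma_finite M M ..
  have spM: "space M = {a..b}"
    unfolding M_def by simp
  have pM: "integrable M p" and \<sigma>M: "integrable M \<sigma>"
    unfolding M_def using p \<sigma> by (auto intro: absolutely_integrable_imp_integrable)
  have [measurable]: "p \<in> borel_measurable M" "\<sigma> \<in> borel_measurable M"
    using pM \<sigma>M by auto
  have [measurable]: "(\<lambda>x. x) \<in> borel_measurable M"
    unfolding M_def by (intro measurable_restrict_space1 measurable_completion) simp
  have kb: "(\<lambda>(r, s). k r s) \<in> borel_measurable borel"
    using k by (rule borel_measurable_continuous_onI)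
  have "(\<lambda>z. (\<lambda>(r, s). k r s) (fst z, snd z)) \<in> borel_measurable (M \<Otimes>\<^sub>M M)"
  proof (rule measurable_compose[OF _ kb])
    have "(\<lambda>z. (fst z, snd z)) \<in> M \<Otimes>\<^sub>M M \<rightarrow>\<^sub>M (borel :: real measure) \<Otimes>\<^sub>M (borel :: real measure)"
      by (intro measurable_Pair measurable_compose[OF measurable_fst] measurable_compose[OF measurable_snd]) measurable
    then show "(\<lambda>z. (fst z, snd z)) \<in> borel_measurable (M \<Otimes>\<^sub>M M)"
      by (simp only: borel_prod)
  qed
  then have km [measurable]: "(\<lambda>z. k (fst z) (snd z)) \<in> borel_measurable (M \<Otimes>\<^sub>M M)"
    by simp
  obtain B where B: "\<And>r s. r \<in> {a..b} \<Longrightarrow> s \<in> {a..b} \<Longrightarrow> \<bar>k r s\<bar> \<le> B"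
  proof -
    have "compact ((\<lambda>(r, s). k r s) ` ({a..b} \<times> {a..b}))"
      by (intro compact_continuous_image continuous_on_subset[OF k] compact_Times) auto
    then obtain B where "\<forall>x\<in>(\<lambda>(r, s). k r s) ` ({a..b} \<times> {a..b}). norm x \<le> B"
      using compact_imp_bounded bounded_iff by metis
    then show ?thesis by (intro that[of B]) auto
  qed
  have prod: "integrable (M \<Otimes>\<^sub>M M) (\<lambda>z. p (fst z) * \<sigma> (snd z))"
  proof (rule Fubini_integrable)
    show "integrable M (\<lambda>x. \<integral>y. norm (p (fst (x, y)) * \<sigma> (snd (x, y))) \<partial>M)"
      using pM \<sigma>M by (simp add: abs_mult)
    show "AE x in M. integrable M (\<lambda>y. p (fst (x, y)) * \<sigma> (snd (x, y)))"
      using \<sigma>M by simp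
  qed measurable
  have "integrable (M \<Otimes>\<^sub>M M) (\<lambda>z. k (fst z) (snd z) * (p (fst z) * \<sigma> (snd z)))"
  proof (rule Bochner_Integration.integrable_bound)
    show "integrable (M \<Otimes>\<^sub>M M) (\<lambda>z. B * (p (fst z) * \<sigma> (snd z)))"
      using prod by simp
    show "AE z in M \<Otimes>\<^sub>M M. norm (k (fst z) (snd z) * (p (fst z) * \<sigma> (snd z)))
                                   \<le> norm (B * (p (fst z) * \<sigma> (snd z)))"
    proof (rule AE_I2)
      fix z assume "z \<in> space (M \<Otimes>\<^sub>M M)"
      then have "\<bar>k (fst z) (snd z)\<bar> \<le> B"
        by (intro B) (auto simp: space_pair_measure spM)
      then have "\<bar>k (fst z) (snd z)\<bar> \<le> \<bar>B\<bar>" by linarith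
      then show "norm (k (fst z) (snd z) * (p (fst z) * \<sigma> (snd z))) \<le> norm (B * (p (fst z) * \<sigma> (snd z)))"
        by (simp add: abs_mult mult_right_mono)
    qed
  qed measurable
  then have "integrable (M \<Otimes>\<^sub>M M) (\<lambda>(r, s). k r s * (p r * \<sigma> s))"
    by (simp add: split_def)
  note swap = Fubini_integral[OF this]
  have kS: "continuous_on ({a..b} \<times> {a..b}) (\<lambda>(r, s). k r s)"
    using k by (rule continuous_on_subset) simp
  have kc: "r \<in> {a..b} \<Longrightarrow> continuous_on {a..b} (\<lambda>s. k r s)"
    "s \<in> {a..b} \<Longrightarrow> continuous_on {a..b} (\<lambda>r. k r s)" for r s
    using continuous_on_section[OF kS] by blast+
  have LI: "integral\<^sup>L M f = integral {a..b} f" if "f absolutely_integrable_on {a..b}" for f :: "real \<Rightarrow> real"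
    unfolding M_def using that by (intro lebesgue_integral_eq_integral absolutely_integrable_imp_integrable) auto
  have c1: "continuous_on {a..b} (\<lambda>r. integral {a..b} (\<lambda>s. k r s * \<sigma> s))"
    by (rule continuous_on_parametric_integral[OF continuous_on_subset[OF k] \<sigma>]) auto
  have c2: "continuous_on {a..b} (\<lambda>s. integral {a..b} (\<lambda>r. k r s * p r))"
  proof (rule continuous_on_parametric_integral[OF _ p])
    have "continuous_on ({a..b} \<times> {a..b}) (\<lambda>z. (\<lambda>(r, s). k r s) (snd z, fst z))"
      by (rule continuous_on_compose2[OF k]) (auto intro!: continuous_intros)
    then show "continuous_on ({a..b} \<times> {a..b}) (\<lambda>(s, r). k r s)"
      by (simp add: split_def)
  qed
  have "(\<integral>r. (\<integral>s. k r s * (p r * \<sigma> s) \<partial>M) \<partial>M) = (\<integral>r. integral {a..b} (\<lambda>s. k r s * \<sigma> s) * p r \<partial>M)"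
  proof (rule Bochner_Integration.integral_cong[OF refl])
    fix r assume "r \<in> space M"
    then have r: "r \<in> {a..b}" by (simp add: spM)
    have "(\<integral>s. k r s * (p r * \<sigma> s) \<partial>M) = (\<integral>s. p r * (k r s * \<sigma> s) \<partial>M)"
      by (simp add: mult_ac)
    also have "\<dots> = p r * (\<integral>s. k r s * \<sigma> s \<partial>M)"
      by simp
    finally show "(\<integral>s. k r s * (p r * \<sigma> s) \<partial>M) = integral {a..b} (\<lambda>s. k r s * \<sigma> s) * p r"
      using LI[OF absolutely_integrable_continuous_mult[OF kc(1)[OF r] \<sigma>]] by simp
  qed
  also have "\<dots> = integral {a..b} (\<lambda>r. integral {a..b} (\<lambda>s. k r s * \<sigma> s) * p r)"
    by (rule LI[OF absolutely_integrable_continuous_mult[OF c1 p]])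
  finally have 1: "(\<integral>r. (\<integral>s. k r s * (p r * \<sigma> s) \<partial>M) \<partial>M)
                     = integral {a..b} (\<lambda>r. integral {a..b} (\<lambda>s. k r s * \<sigma> s) * p r)" .
  have "(\<integral>s. (\<integral>r. k r s * (p r * \<sigma> s) \<partial>M) \<partial>M) = (\<integral>s. integral {a..b} (\<lambda>r. k r s * p r) * \<sigma> s \<partial>M)"
  proof (rule Bochner_Integration.integral_cong[OF refl])
    fix s assume "s \<in> space M"
    then have s: "s \<in> {a..b}" by (simp add: spM)
    have "(\<integral>r. k r s * (p r * \<sigma> s) \<partial>M) = (\<integral>r. (k r s * p r) * \<sigma> s \<partial>M)"
      by (simp add: mult_ac)
    also have "\<dots> = (\<integral>r. k r s * p r \<partial>M) * \<sigma> s"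
      by simp
    finally show "(\<integral>r. k r s * (p r * \<sigma> s) \<partial>M) = integral {a..b} (\<lambda>r. k r s * p r) * \<sigma> s"
      using LI[OF absolutely_integrable_continuous_mult[OF kc(2)[OF s] p]] by simp
  qed
  also have "\<dots> = integral {a..b} (\<lambda>s. integral {a..b} (\<lambda>r. k r s * p r) * \<sigma> s)"
    by (rule LI[OF absolutely_integrable_continuous_mult[OF c2 \<sigma>]])
  finally show ?thesis
    using 1 swap by (simp add: mult.commute)
qed

section \<open>Solutions of the differential equation\<close>

lemma AE_lebesgue_affine:
  fixes P :: "real \<Rightarrow> bool"
  assumes "AE x in lebesgue. P x" and e: "e \<noteq> 0"
  shows "AE t in lebesgue. P (p + e * t)"
proof -
  obtain N where N: "negligible N" "{x. \<not> P x} \<subseteq> N"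
    using assms(1) by (auto simp: eventually_ae_filter negligible_iff_null_sets)
  have "negligible ((\<lambda>x. (x - p) / e) ` N)"
    by (rule negligible_differentiable_image_negligible[OF _ N(1)]) (auto intro!: derivative_intros e simp: differentiable_on_def)
  moreover have "{t. \<not> P (p + e * t)} \<subseteq> (\<lambda>x. (x - p) / e) ` N"
  proof
    fix t assume "t \<in> {t. \<not> P (p + e * t)}"
    then have "p + e * t \<in> N" using N(2) by auto
    moreover have "t = (p + e * t - p) / e" using e by simp
    ultimately show "t \<in> (\<lambda>x. (x - p) / e) ` N" by blast
  qed
  ultimately show ?thesis
    by (auto simp: eventually_ae_filter negligible_iff_null_sets)
qed

lemma has_real_derivative_cong_on:
  assumes "(f has_real_derivative D) (at x within A)" "x \<in> A" "\<And>y. y \<in> A \<Longrightarrow> g y = f y"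
  shows "(g has_real_derivative D) (at x within A)"
  using assms unfolding has_field_derivative_def by (auto intro: has_derivative_transform)

lemma deriv_on_eq:
  assumes "(u has_real_derivative D) (at t within {c..d})" "t \<in> {c..d}" "c < d"
  shows "deriv_on c d u t = D"
  unfolding deriv_on_def
  using assms by (intro vector_derivative_within_closed_interval)
    (auto simp: has_real_derivative_iff_has_vector_derivative)

lemma W21_has_real_derivative:
  assumes "u \<in> W21 c d" "t \<in> {c..d}"
  shows "(u has_real_derivative deriv_on c d u t) (at t within {c..d})"
  using assms unfolding W21_def differentiable_on_def deriv_on_def
  by (auto simp: has_real_derivative_iff_has_vector_derivative simp flip: vector_derivative_works)

text \<open>
  A boundary value problem stripped of its boundary conditions: this part is stable under linear
  combination, restriction and reflection, whereas the boundary conditions change.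
\<close>
definition ode_solution :: "(real \<Rightarrow> real) \<Rightarrow> real \<Rightarrow> (real \<Rightarrow> real) \<Rightarrow> (real \<Rightarrow> real) \<Rightarrow> bool" where
  "ode_solution q S \<sigma> u \<longleftrightarrow>
     u \<in> W21 0 S \<and>
     (AE t in lebesgue. t \<in> {0..S} \<longrightarrow>
        (deriv_on 0 S u has_real_derivative (\<sigma> t - q t * u t)) (at t within {0..S}))"

lemma bvp_solution_iff: "bvp_solution B q S \<sigma> u \<longleftrightarrow> ode_solution q S \<sigma> u \<and> boundary B S u"
  unfolding bvp_solution_def ode_solution_def by blast

lemma ode_solutionI:
  assumes S: "S > 0"
    and u: "\<And>t. t \<in> {0..S} \<Longrightarrow> (u has_real_derivative v t) (at t within {0..S})"
    and v: "abs_cont_on 0 S v"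
    and ode: "AE t in lebesgue. t \<in> {0..S} \<longrightarrow> (v has_real_derivative (\<sigma> t - q t * u t)) (at t within {0..S})"
  shows "ode_solution q S \<sigma> u" and "\<And>t. t \<in> {0..S} \<Longrightarrow> deriv_on 0 S u t = v t"
proof -
  show d: "deriv_on 0 S u t = v t" if "t \<in> {0..S}" for t
    using deriv_on_eq[OF u[OF that] that S] .
  have "u differentiable_on {0..S}"
    unfolding differentiable_on_def using u real_differentiable_def by blast
  moreover have ac: "abs_cont_on 0 S (deriv_on 0 S u)"
    by (rule abs_cont_on_cong[OF v d])
  moreover have "AE t in lebesgue. t \<in> {0..S} \<longrightarrow>
        (deriv_on 0 S u has_real_derivative (\<sigma> t - q t * u t)) (at t within {0..S})"
    using ode by eventually_elim (auto intro: has_real_derivative_cong_on d)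
  ultimately show "ode_solution q S \<sigma> u"
    unfolding ode_solution_def W21_def using abs_cont_on_imp_continuous_on by blast
qed

lemma ode_solution_linear:
  assumes S: "S > 0" and 1: "ode_solution q S \<sigma>1 u1" and 2: "ode_solution q S \<sigma>2 u2"
  shows "ode_solution q S (\<lambda>t. \<sigma>1 t + k * \<sigma>2 t) (\<lambda>t. u1 t + k * u2 t)"
    and "\<And>t. t \<in> {0..S} \<Longrightarrow> deriv_on 0 S (\<lambda>t. u1 t + k * u2 t) t = deriv_on 0 S u1 t + k * deriv_on 0 S u2 t"
proof -
  have w: "u1 \<in> W21 0 S" "u2 \<in> W21 0 S" using 1 2 by (auto simp: ode_solution_def)
  have d: "((\<lambda>t. u1 t + k * u2 t) has_real_derivative deriv_on 0 S u1 t + k * deriv_on 0 S u2 t) (at t within {0..S})"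
    if "t \<in> {0..S}" for t
    by (intro DERIV_add DERIV_cmult W21_has_real_derivative w that)
  have ac: "abs_cont_on 0 S (\<lambda>t. deriv_on 0 S u1 t + k * deriv_on 0 S u2 t)"
    using w unfolding W21_def by (intro abs_cont_on_add abs_cont_on_cmult) auto
  have "AE t in lebesgue. t \<in> {0..S} \<longrightarrow> (deriv_on 0 S u1 has_real_derivative \<sigma>1 t - q t * u1 t) (at t within {0..S})"
    and "AE t in lebesgue. t \<in> {0..S} \<longrightarrow> (deriv_on 0 S u2 has_real_derivative \<sigma>2 t - q t * u2 t) (at t within {0..S})"
    using 1 2 by (auto simp only: ode_solution_def)
  then have ae: "AE t in lebesgue. t \<in> {0..S} \<longrightarrow>
      ((\<lambda>t. deriv_on 0 S u1 t + k * deriv_on 0 S u2 t) has_real_derivative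
          (\<sigma>1 t + k * \<sigma>2 t - q t * (u1 t + k * u2 t))) (at t within {0..S})"
  proof (eventually_elim, intro impI)
    fix t assume t: "t \<in> {0..S}"
      and "t \<in> {0..S} \<longrightarrow> (deriv_on 0 S u1 has_real_derivative \<sigma>1 t - q t * u1 t) (at t within {0..S})"
          "t \<in> {0..S} \<longrightarrow> (deriv_on 0 S u2 has_real_derivative \<sigma>2 t - q t * u2 t) (at t within {0..S})"
    then have "((\<lambda>t. deriv_on 0 S u1 t + k * deriv_on 0 S u2 t) has_real_derivative
          ((\<sigma>1 t - q t * u1 t) + k * (\<sigma>2 t - q t * u2 t))) (at t within {0..S})"
      by (intro DERIV_add DERIV_cmult) auto
    then show "((\<lambda>t. deriv_on 0 S u1 t + k * deriv_on 0 S u2 t) has_real_derivative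
          (\<sigma>1 t + k * \<sigma>2 t - q t * (u1 t + k * u2 t))) (at t within {0..S})"
      by (simp add: algebra_simps)
  qed
  show "ode_solution q S (\<lambda>t. \<sigma>1 t + k * \<sigma>2 t) (\<lambda>t. u1 t + k * u2 t)"
    and "\<And>t. t \<in> {0..S} \<Longrightarrow> deriv_on 0 S (\<lambda>t. u1 t + k * u2 t) t = deriv_on 0 S u1 t + k * deriv_on 0 S u2 t"
    using ode_solutionI[OF S d ac ae] by blast+
qed

text \<open>
  The equation has no first order term, so it is invariant under \<open>t \<mapsto> p + e * t\<close> with
  \<open>e = 1\<close> or \<open>e = -1\<close>; the first derivative picks up the sign \<open>e\<close>.
\<close>
lemma ode_solution_affine:
  assumes S: "S > 0" and w: "ode_solution q L \<sigma> w" and e: "e = 1 \<or> e = -1"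
    and maps: "\<And>t. t \<in> {0..S} \<Longrightarrow> p + e * t \<in> {0..L}"
  shows "ode_solution (\<lambda>t. q (p + e * t)) S (\<lambda>t. \<sigma> (p + e * t)) (\<lambda>t. w (p + e * t))"
    and "\<And>t. t \<in> {0..S} \<Longrightarrow> deriv_on 0 S (\<lambda>t. w (p + e * t)) t = e * deriv_on 0 L w (p + e * t)"
proof -
  have wW: "w \<in> W21 0 L" using w by (auto simp: ode_solution_def)
  have chain: "((\<lambda>t. f (p + e * t)) has_real_derivative e * D) (at t within {0..S})"
    if "t \<in> {0..S}" "(f has_real_derivative D) (at (p + e * t) within {0..L})" for f t D
  proof -
    have "(f has_real_derivative D) (at (p + e * t) within (\<lambda>t. p + e * t) ` {0..S})"
      by (rule DERIV_subset[OF that(2)]) (use maps in blast)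
    moreover have "((\<lambda>t. p + e * t) has_real_derivative e) (at t within {0..S})"
      by (auto intro!: derivative_eq_intros)
    ultimately have "(f \<circ> (\<lambda>t. p + e * t) has_real_derivative D * e) (at t within {0..S})"
      by (rule DERIV_image_chain)
    then show ?thesis by (simp add: o_def mult.commute)
  qed
  have d: "((\<lambda>t. w (p + e * t)) has_real_derivative e * deriv_on 0 L w (p + e * t)) (at t within {0..S})"
    if "t \<in> {0..S}" for t
    by (rule chain[OF that W21_has_real_derivative[OF wW maps[OF that]]])
  have ac: "abs_cont_on 0 S (\<lambda>t. e * deriv_on 0 L w (p + e * t))"
    using wW unfolding W21_def by (intro abs_cont_on_cmult abs_cont_on_affine[of 0 L] e maps) auto
  have "AE t in lebesgue. p + e * t \<in> {0..L} \<longrightarrow>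
        (deriv_on 0 L w has_real_derivative (\<sigma> (p + e * t) - q (p + e * t) * w (p + e * t))) (at (p + e * t) within {0..L})"
    using w e unfolding ode_solution_def by (intro AE_lebesgue_affine) auto
  then have ae: "AE t in lebesgue. t \<in> {0..S} \<longrightarrow>
      ((\<lambda>t. e * deriv_on 0 L w (p + e * t)) has_real_derivative
          (\<sigma> (p + e * t) - q (p + e * t) * w (p + e * t))) (at t within {0..S})"
  proof (eventually_elim, intro impI)
    fix t assume t: "t \<in> {0..S}" and "p + e * t \<in> {0..L} \<longrightarrow>
        (deriv_on 0 L w has_real_derivative (\<sigma> (p + e * t) - q (p + e * t) * w (p + e * t))) (at (p + e * t) within {0..L})"
    then have "((\<lambda>t. e * deriv_on 0 L w (p + e * t)) has_real_derivative
          e * (e * (\<sigma> (p + e * t) - q (p + e * t) * w (p + e * t)))) (at t within {0..S})"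
      using maps by (intro DERIV_cmult chain) auto
    then show "((\<lambda>t. e * deriv_on 0 L w (p + e * t)) has_real_derivative
          (\<sigma> (p + e * t) - q (p + e * t) * w (p + e * t))) (at t within {0..S})"
      using e by auto
  qed
  show "ode_solution (\<lambda>t. q (p + e * t)) S (\<lambda>t. \<sigma> (p + e * t)) (\<lambda>t. w (p + e * t))"
    and "\<And>t. t \<in> {0..S} \<Longrightarrow> deriv_on 0 S (\<lambda>t. w (p + e * t)) t = e * deriv_on 0 L w (p + e * t)"
    using ode_solutionI[OF S d ac, where q="\<lambda>t. q (p + e * t)" and \<sigma>="\<lambda>t. \<sigma> (p + e * t)"] ae by blast+
qed

lemma ode_solution_cong:
  assumes S: "S > 0" and u: "ode_solution q S \<sigma> u"
    and eq: "\<And>t. t \<in> {0..S} \<Longrightarrow> u' t = u t"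
    and data: "AE t in lebesgue. t \<in> {0..S} \<longrightarrow> q' t = q t \<and> \<sigma>' t = \<sigma> t"
  shows "ode_solution q' S \<sigma>' u'"
    and "\<And>t. t \<in> {0..S} \<Longrightarrow> deriv_on 0 S u' t = deriv_on 0 S u t"
proof -
  have uW: "u \<in> W21 0 S" using u by (auto simp: ode_solution_def)
  have d: "(u' has_real_derivative deriv_on 0 S u t) (at t within {0..S})" if "t \<in> {0..S}" for t
    by (rule has_real_derivative_cong_on[OF W21_has_real_derivative[OF uW that] that eq])
  have ac: "abs_cont_on 0 S (deriv_on 0 S u)"
    using uW by (simp add: W21_def)
  have "AE t in lebesgue. t \<in> {0..S} \<longrightarrow> (deriv_on 0 S u has_real_derivative \<sigma> t - q t * u t) (at t within {0..S})"
    using u by (simp only: ode_solution_def)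
  with data have ae: "AE t in lebesgue. t \<in> {0..S} \<longrightarrow> (deriv_on 0 S u has_real_derivative (\<sigma>' t - q' t * u' t)) (at t within {0..S})"
    by eventually_elim (auto simp: eq)
  show "ode_solution q' S \<sigma>' u'"
    and "\<And>t. t \<in> {0..S} \<Longrightarrow> deriv_on 0 S u' t = deriv_on 0 S u t"
    using ode_solutionI[OF S d ac ae] by blast+
qed

text \<open>
  The kernel \<open>ramp (y - r) - ramp (t - r) - (y - t)\<close> (with the last term only for \<open>r \<le> t\<close>) vanishes
  unless \<open>r\<close> lies between \<open>t\<close> and \<open>y\<close>, and is at most \<open>\<bar>y - t\<bar>\<close> there.  The error of
  the linear approximation is thus \<open>\<bar>y - t\<bar>\<close> times the integral of \<open>\<bar>f\<bar>\<close> between \<open>t\<close> and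
  \<open>y\<close>, which tends to \<open>0\<close>; so the derivative exists at every point, not only almost everywhere.
\<close>
lemma has_real_derivative_second_primitive:
  fixes f :: "real \<Rightarrow> real"
  assumes f: "f absolutely_integrable_on {0..S}" and t: "t \<in> {0..S}"
  shows "((\<lambda>t. integral {0..S} (\<lambda>r. ramp (t - r) * f r)) has_real_derivative integral {0..t} f) (at t within {0..S})"
proof -
  define R where "R = (\<lambda>t. integral {0..S} (\<lambda>r. ramp (t - r) * f r))"
  define G where "G = (\<lambda>t. integral {0..t} (\<lambda>r. \<bar>f r\<bar>))"
  have fi: "f integrable_on {0..S}" and fn: "(\<lambda>r. \<bar>f r\<bar>) integrable_on {0..S}"
    using f by (auto simp: absolutely_integrable_on_def)
  have Ri: "(\<lambda>r. ramp (y - r) * f r) integrable_on {0..S}" for y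
  proof -
    have "continuous_on {0..S} (\<lambda>r. ramp (y - r))" by (intro continuous_intros)
    from absolutely_integrable_continuous_mult[OF this f] show ?thesis
      by (simp add: absolutely_integrable_on_def)
  qed
  have est: "\<bar>R y - R t - integral {0..t} f * (y - t)\<bar> \<le> \<bar>G y - G t\<bar> * \<bar>y - t\<bar>" if y: "y \<in> {0..S}" for y
  proof -
    define lo hi where "lo = min t y" and "hi = max t y"
    have lh: "0 \<le> lo" "lo \<le> hi" "hi \<le> S" using t y by (auto simp: lo_def hi_def)
    have St: "{0..S} \<inter> {..t} = {0..t}" "{..t} \<inter> {0..S} = {0..t}" using t by auto
    have Sl: "{0..S} \<inter> {lo..hi} = {lo..hi}" "{lo..hi} \<inter> {0..S} = {lo..hi}" using lh by auto
    have hi_f: "(\<lambda>r. if r \<in> {..t} then f r else 0) integrable_on {0..S}"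
      unfolding integrable_restrict_Int St by (rule integrable_subinterval_real[OF fi]) (use t in auto)
    have lo_f: "(\<lambda>r. if r \<in> {lo..hi} then \<bar>f r\<bar> else 0) integrable_on {0..S}"
      unfolding integrable_restrict_Int Sl by (rule integrable_subinterval_real[OF fn]) (use lh in auto)
    define D where "D = (\<lambda>r. ramp (y - r) * f r - ramp (t - r) * f r - (if r \<in> {..t} then f r else 0) * (y - t))"
    have D_i: "D integrable_on {0..S}"
      unfolding D_def by (intro integrable_diff Ri integrable_on_mult_left hi_f)
    have "R y - R t - integral {0..t} f * (y - t) = integral {0..S} D"
      unfolding D_def R_def
      using hi_f Ri by (simp only: integral_diff integrable_diff integrable_on_mult_left integral_mult_left integral_restrict_Int St)
    also have "norm \<dots> \<le> integral {0..S} (\<lambda>r. (if r \<in> {lo..hi} then \<bar>f r\<bar> else 0) * \<bar>y - t\<bar>)"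
    proof (rule integral_norm_bound_integral[OF D_i])
      show "(\<lambda>r. (if r \<in> {lo..hi} then \<bar>f r\<bar> else 0) * \<bar>y - t\<bar>) integrable_on {0..S}"
        by (intro integrable_on_mult_left lo_f)
      fix r
      define \<kappa> where "\<kappa> = ramp (y - r) - ramp (t - r) - (if r \<in> {..t} then 1 else 0) * (y - t)"
      have "D r = \<kappa> * f r"
        unfolding D_def \<kappa>_def by (simp add: algebra_simps)
      moreover have "\<bar>\<kappa>\<bar> \<le> (if r \<in> {lo..hi} then 1 else 0) * \<bar>y - t\<bar>"
        unfolding \<kappa>_def ramp_def lo_def hi_def by (auto simp: max_def min_def)
      ultimately show "norm (D r) \<le> (if r \<in> {lo..hi} then \<bar>f r\<bar> else 0) * \<bar>y - t\<bar>"
        using mult_right_mono[of "\<bar>\<kappa>\<bar>" _ "\<bar>f r\<bar>"] by (fastforce simp: abs_mult mult.commute split: if_splits)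
    qed
    also have "\<dots> = integral {lo..hi} (\<lambda>r. \<bar>f r\<bar>) * \<bar>y - t\<bar>"
      by (simp only: integral_mult_left integral_restrict_Int Sl)
    also have "integral {lo..hi} (\<lambda>r. \<bar>f r\<bar>) = G hi - G lo"
    proof -
      have "(\<lambda>r. \<bar>f r\<bar>) integrable_on {0..hi}"
        by (rule integrable_subinterval_real[OF fn]) (use lh in auto)
      with lh show ?thesis
        using Henstock_Kurzweil_Integration.integral_combine[where a=0 and c=lo and b=hi and f="\<lambda>r. \<bar>f r\<bar>"]
        by (simp add: G_def)
    qed
    also have "G hi - G lo \<le> \<bar>G y - G t\<bar>"
      by (auto simp: lo_def hi_def max_def min_def)
    finally show ?thesis by (simp add: mult_right_mono)
  qed
  have G: "continuous_on {0..S} G"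
    unfolding G_def by (rule indefinite_integral_continuous_1[OF fn])
  show ?thesis
    unfolding has_field_derivative_def has_derivative_within_alt R_def[symmetric]
  proof (intro conjI allI impI bounded_linear_mult_right)
    fix e :: real assume "e > 0"
    then obtain d where "d > 0" and d: "\<And>y. y \<in> {0..S} \<Longrightarrow> \<bar>y - t\<bar> < d \<Longrightarrow> \<bar>G y - G t\<bar> < e"
      using G t unfolding continuous_on_iff dist_real_def by blast
    have "norm (R y - R t - integral {0..t} f * (y - t)) \<le> e * norm (y - t)"
      if "y \<in> {0..S}" "norm (y - t) < d" for y
      using order_trans[OF est[OF that(1)] mult_right_mono[of "\<bar>G y - G t\<bar>" e "\<bar>y - t\<bar>"]] d[of y] that by auto
    then show "\<exists>d>0. \<forall>y\<in>{0..S}. norm (y - t) < d \<longrightarrow> norm (R y - R t - integral {0..t} f * (y - t)) \<le> e * norm (y - t)"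
      using \<open>d > 0\<close> by blast
  qed
qed

text \<open>
  Here \<open>u'\<close> is an indefinite integral of an \<open>L\<^sup>1\<close> function: it is absolutely continuous, and
  Lebesgue's differentiation theorem gives \<open>u''\<close> almost everywhere.
\<close>
lemma volterra_imp_ode_solution:
  assumes S: "S > 0" and q: "q absolutely_integrable_on {0..S}" and \<sigma>: "\<sigma> absolutely_integrable_on {0..S}"
    and u: "continuous_on {0..S} u"
    and eq: "\<And>t. t \<in> {0..S} \<Longrightarrow> u t = \<alpha> + \<beta> * t + integral {0..S} (\<lambda>r. ramp (t - r) * (\<sigma> r - q r * u r))"
  shows "ode_solution q S \<sigma> u"
    and "\<And>t. t \<in> {0..S} \<Longrightarrow> deriv_on 0 S u t = \<beta> + integral {0..t} (\<lambda>r. \<sigma> r - q r * u r)"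
proof -
  define f where "f = (\<lambda>r. \<sigma> r - q r * u r)"
  have f: "f absolutely_integrable_on {0..S}"
    unfolding f_def using absolutely_integrable_continuous_mult[OF u q] \<sigma>
    by (intro set_integral_diff) (simp_all add: mult.commute)
  have d: "(u has_real_derivative \<beta> + integral {0..t} f) (at t within {0..S})" if t: "t \<in> {0..S}" for t
  proof -
    have "((\<lambda>t. \<alpha> + \<beta> * t + integral {0..S} (\<lambda>r. ramp (t - r) * f r)) has_real_derivative \<beta> + integral {0..t} f) (at t within {0..S})"
      by (rule derivative_eq_intros has_real_derivative_second_primitive[OF f t] refl)+ simp
    then show ?thesis
      by (rule has_real_derivative_cong_on[OF _ t]) (simp add: eq f_def)
  qed
  have ac: "abs_cont_on 0 S (\<lambda>t. \<beta> + integral {0..t} f)"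
    using abs_cont_on_indefinite_integral[OF f] by (simp add: abs_cont_on_def)
  have "AE t in lebesgue. t \<in> {0..S} \<longrightarrow> ((\<lambda>t. integral {0..t} f) has_real_derivative f t) (at t within {0..S})"
    using f by (intro indefinite_integral_has_derivative_ae) (simp add: absolutely_integrable_on_def)
  then have ae: "AE t in lebesgue. t \<in> {0..S} \<longrightarrow>
      ((\<lambda>t. \<beta> + integral {0..t} f) has_real_derivative (\<sigma> t - q t * u t)) (at t within {0..S})"
    by eventually_elim (auto intro!: derivative_eq_intros simp: f_def)
  show "ode_solution q S \<sigma> u"
    and "\<And>t. t \<in> {0..S} \<Longrightarrow> deriv_on 0 S u t = \<beta> + integral {0..t} (\<lambda>r. \<sigma> r - q r * u r)"
    using ode_solutionI[OF S d ac ae] unfolding f_def by blast+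
qed

section \<open>Existence of Green's functions\<close>

text \<open>
  All six kinds of boundary conditions are a pair of linear equations in \<open>u 0\<close>, \<open>u' 0\<close>, \<open>u S\<close>,
  \<open>u' S\<close>; the quadruple holds the four coefficients of such an equation.
\<close>
definition boundary_form :: "real \<times> real \<times> real \<times> real \<Rightarrow> real \<Rightarrow> (real \<Rightarrow> real) \<Rightarrow> real" where
  "boundary_form = (\<lambda>(p0, p1, p2, p3) S u. p0 * u 0 + p1 * deriv_on 0 S u 0 + p2 * u S + p3 * deriv_on 0 S u S)"

lemma boundary_iff_forms:
  obtains P R where "\<And>S u. boundary B S u \<longleftrightarrow> boundary_form P S u = 0 \<and> boundary_form R S u = 0"
proof (cases B)
  case Periodic
  then show ?thesis by (intro that[of "(1, 0, -1, 0)" "(0, 1, 0, -1)"]) (auto simp: boundary_form_def)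
next
  case Antiperiodic
  then show ?thesis by (intro that[of "(1, 0, 1, 0)" "(0, 1, 0, 1)"]) (auto simp: boundary_form_def)
next
  case Neumann
  then show ?thesis by (intro that[of "(0, 1, 0, 0)" "(0, 0, 0, 1)"]) (auto simp: boundary_form_def)
next
  case Dirichlet
  then show ?thesis by (intro that[of "(1, 0, 0, 0)" "(0, 0, 1, 0)"]) (auto simp: boundary_form_def)
next
  case Mixed1
  then show ?thesis by (intro that[of "(0, 1, 0, 0)" "(0, 0, 1, 0)"]) (auto simp: boundary_form_def)
next
  case Mixed2
  then show ?thesis by (intro that[of "(1, 0, 0, 0)" "(0, 0, 0, 1)"]) (auto simp: boundary_form_def)
qed

lemma boundary_form_linear:
  assumes "S > 0" "ode_solution q S \<sigma>1 u1" "ode_solution q S \<sigma>2 u2"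
  shows "boundary_form P S (\<lambda>t. u1 t + k * u2 t) = boundary_form P S u1 + k * boundary_form P S u2"
  using ode_solution_linear(2)[OF assms, of 0] ode_solution_linear(2)[OF assms, of S] assms(1)
  by (cases P) (simp add: boundary_form_def algebra_simps)

lemma volterra_initial_value:
  assumes "S > 0"
    and "\<And>t. t \<in> {0..S} \<Longrightarrow> u t = \<alpha> + \<beta> * t + integral {0..S} (\<lambda>r. ramp (t - r) * f r)"
  shows "u 0 = \<alpha>"
proof -
  have "integral {0..S} (\<lambda>r. ramp (0 - r) * f r) = integral {0..S} (\<lambda>r. 0)"
    by (rule integral_cong) (auto simp: ramp_def)
  with assms show ?thesis by simp
qed

lemma homogeneous_solution_exists:
  assumes S: "S > 0" and q: "q absolutely_integrable_on {0..S}"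
  obtains y where "continuous_on {0..S} y" "ode_solution q S (\<lambda>_. 0) y" "y 0 = \<alpha>" "deriv_on 0 S y 0 = \<beta>"
proof -
  have "continuous_on UNIV (\<lambda>(t :: real, s :: real). \<alpha> + \<beta> * t)"
    unfolding split_def by (intro continuous_intros)
  then obtain K where K: "continuous_on UNIV (\<lambda>(t, s). K t s)"
    and Keq: "\<And>t s. t \<in> {0..S} \<Longrightarrow> s \<in> {0..S} \<Longrightarrow>
           K t s = \<alpha> + \<beta> * t - integral {0..S} (\<lambda>r. ramp (t - r) * (q r * K r s))"
    using volterra_solution_exists[OF S q] by blast
  define y where "y = (\<lambda>t. K t 0)"
  have "continuous_on UNIV y"
    unfolding y_def by (rule continuous_on_section(2)[of UNIV UNIV]) (use K in auto)
  then have yc: "continuous_on {0..S} y"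
    by (rule continuous_on_subset) auto
  have eq: "y t = \<alpha> + \<beta> * t + integral {0..S} (\<lambda>r. ramp (t - r) * (0 - q r * y r))" if "t \<in> {0..S}" for t
    using Keq[OF that, of 0] S by (simp add: y_def)
  show ?thesis
  proof (rule that[OF yc])
    show "ode_solution q S (\<lambda>_. 0) y"
      by (rule volterra_imp_ode_solution(1)[OF S q _ yc eq]) auto
    show "y 0 = \<alpha>" by (rule volterra_initial_value[OF S eq])
    show "deriv_on 0 S y 0 = \<beta>"
      using volterra_imp_ode_solution(2)[OF S q _ yc eq, of 0] S by simp
  qed
qed

text \<open>
  \<open>K(\<cdot>,s)\<close> solves the homogeneous equation after a unit jump of the derivative at \<open>s\<close>, and vanishes before
  \<open>s\<close>.  Superposition over \<open>s\<close> commutes with the Volterra operator by Fubini's theorem, so it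
  solves the inhomogeneous equation with zero Cauchy data at \<open>0\<close>.  The derivative at \<open>S\<close> is
  again an integral of \<open>\<sigma>\<close> against a continuous kernel \<open>D\<close>; the boundary conditions need this.
\<close>
lemma initial_value_kernel_exists:
  assumes S: "S > 0" and q: "q absolutely_integrable_on {0..S}"
  obtains K D where "continuous_on ({0..S} \<times> {0..S}) (\<lambda>(t, s). K t s)" "continuous_on {0..S} D"
    "\<And>\<sigma>. \<sigma> absolutely_integrable_on {0..S} \<Longrightarrow>
        ode_solution q S \<sigma> (\<lambda>t. integral {0..S} (\<lambda>s. K t s * \<sigma> s)) \<and>
        integral {0..S} (\<lambda>s. K 0 s * \<sigma> s) = 0 \<and>
        deriv_on 0 S (\<lambda>t. integral {0..S} (\<lambda>s. K t s * \<sigma> s)) 0 = 0 \<and>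
        deriv_on 0 S (\<lambda>t. integral {0..S} (\<lambda>s. K t s * \<sigma> s)) S = integral {0..S} (\<lambda>s. D s * \<sigma> s)"
proof -
  have "continuous_on UNIV (\<lambda>(t :: real, s :: real). ramp (t - s))"
    unfolding split_def by (intro continuous_intros)
  then obtain K where K: "continuous_on UNIV (\<lambda>(t, s). K t s)"
    and Keq: "\<And>t s. t \<in> {0..S} \<Longrightarrow> s \<in> {0..S} \<Longrightarrow>
           K t s = ramp (t - s) - integral {0..S} (\<lambda>r. ramp (t - r) * (q r * K r s))"
    using volterra_solution_exists[OF S q] by blast
  have KS: "continuous_on ({0..S} \<times> {0..S}) (\<lambda>(t, s). K t s)"
    by (rule continuous_on_subset[OF K]) auto
  have KS': "continuous_on ({0..S} \<times> {0..S}) (\<lambda>(s, t). K t s)"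
  proof -
    have "continuous_on ({0..S} \<times> {0..S}) (\<lambda>z. (\<lambda>(t, s). K t s) (snd z, fst z))"
      by (rule continuous_on_compose2[OF K]) (auto intro!: continuous_intros)
    then show ?thesis by (simp add: split_def)
  qed
  define D where "D = (\<lambda>s. 1 - integral {0..S} (\<lambda>r. K r s * q r))"
  have Kq: "continuous_on {0..S} (\<lambda>s. integral {0..S} (\<lambda>r. K r s * p r))"
    if "p absolutely_integrable_on {0..S}" for p
    using continuous_on_parametric_integral[OF KS' that] .
  have D: "continuous_on {0..S} D"
    unfolding D_def by (intro continuous_intros Kq q)
  show ?thesis
  proof (rule that[OF KS D])
    fix \<sigma> :: "real \<Rightarrow> real" assume \<sigma>: "\<sigma> absolutely_integrable_on {0..S}"
    define u where "u = (\<lambda>t. integral {0..S} (\<lambda>s. K t s * \<sigma> s))"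
    have uc: "continuous_on {0..S} u"
      unfolding u_def by (rule continuous_on_parametric_integral[OF KS \<sigma>])
    have \<sigma>i: "\<sigma> integrable_on {0..S}"
      using \<sigma> by (simp add: absolutely_integrable_on_def)
    have ci: "(\<lambda>r. f r * g r) integrable_on {0..S}"
      if "continuous_on {0..S} f" "g absolutely_integrable_on {0..S}" for f g :: "real \<Rightarrow> real"
      using absolutely_integrable_continuous_mult[OF that] by (simp add: absolutely_integrable_on_def)
    have rc: "continuous_on {0..S} (\<lambda>r. ramp (t - r))" for t
      by (intro continuous_intros)
    have rq: "(\<lambda>r. ramp (t - r) * q r) absolutely_integrable_on {0..S}" for t
      by (rule absolutely_integrable_continuous_mult[OF rc q])
    have uq: "(\<lambda>r. u r * q r) absolutely_integrable_on {0..S}"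
      by (rule absolutely_integrable_continuous_mult[OF uc q])
    have ueq: "u t = 0 + 0 * t + integral {0..S} (\<lambda>r. ramp (t - r) * (\<sigma> r - q r * u r))" if t: "t \<in> {0..S}" for t
    proof -
      have "u t = integral {0..S} (\<lambda>s. ramp (t - s) * \<sigma> s - integral {0..S} (\<lambda>r. K r s * (ramp (t - r) * q r)) * \<sigma> s)"
        unfolding u_def
      proof (rule integral_cong)
        fix s assume s: "s \<in> {0..S}"
        have "K t s = ramp (t - s) - integral {0..S} (\<lambda>r. K r s * (ramp (t - r) * q r))"
          using Keq[OF t s] by (simp add: mult_ac)
        then show "K t s * \<sigma> s = ramp (t - s) * \<sigma> s - integral {0..S} (\<lambda>r. K r s * (ramp (t - r) * q r)) * \<sigma> s"
          by (simp only: left_diff_distrib)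
      qed
      also have "\<dots> = integral {0..S} (\<lambda>s. ramp (t - s) * \<sigma> s)
                      - integral {0..S} (\<lambda>s. integral {0..S} (\<lambda>r. K r s * (ramp (t - r) * q r)) * \<sigma> s)"
        by (intro integral_diff ci rc Kq rq \<sigma>)
      also have "integral {0..S} (\<lambda>s. integral {0..S} (\<lambda>r. K r s * (ramp (t - r) * q r)) * \<sigma> s)
               = integral {0..S} (\<lambda>r. (ramp (t - r) * q r) * u r)"
        unfolding u_def by (rule integral_swap_continuous_kernel[OF K rq \<sigma>, symmetric])
      also have "integral {0..S} (\<lambda>s. ramp (t - s) * \<sigma> s) - integral {0..S} (\<lambda>r. (ramp (t - r) * q r) * u r)
               = integral {0..S} (\<lambda>r. ramp (t - r) * \<sigma> r - (ramp (t - r) * q r) * u r)"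
        using ci[OF rc \<sigma>] ci[OF uc rq] by (subst integral_diff) (simp_all add: mult.commute)
      finally show ?thesis by (simp add: algebra_simps)
    qed
    have "ode_solution q S \<sigma> u"
      by (rule volterra_imp_ode_solution(1)[OF S q \<sigma> uc ueq])
    moreover have "u 0 = 0"
      by (rule volterra_initial_value[OF S ueq])
    moreover have "deriv_on 0 S u 0 = 0"
      using volterra_imp_ode_solution(2)[OF S q \<sigma> uc ueq, of 0] S by simp
    moreover have "deriv_on 0 S u S = integral {0..S} (\<lambda>s. D s * \<sigma> s)"
    proof -
      have "deriv_on 0 S u S = integral {0..S} (\<lambda>r. \<sigma> r - q r * u r)"
        using volterra_imp_ode_solution(2)[OF S q \<sigma> uc ueq, of S] S by simp
      also have "\<dots> = integral {0..S} \<sigma> - integral {0..S} (\<lambda>r. q r * u r)"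
        using uq \<sigma>i by (intro integral_diff) (auto simp: absolutely_integrable_on_def mult.commute)
      also have "integral {0..S} (\<lambda>r. q r * u r) = integral {0..S} (\<lambda>s. integral {0..S} (\<lambda>r. K r s * q r) * \<sigma> s)"
        unfolding u_def by (rule integral_swap_continuous_kernel[OF K q \<sigma>])
      also have "integral {0..S} \<sigma> - \<dots> = integral {0..S} (\<lambda>s. \<sigma> s - integral {0..S} (\<lambda>r. K r s * q r) * \<sigma> s)"
        by (rule integral_diff[symmetric]) (intro \<sigma>i ci Kq q \<sigma>)+
      finally show ?thesis by (simp add: D_def algebra_simps)
    qed
    ultimately show "ode_solution q S \<sigma> (\<lambda>t. integral {0..S} (\<lambda>s. K t s * \<sigma> s)) \<and>
        integral {0..S} (\<lambda>s. K 0 s * \<sigma> s) = 0 \<and>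
        deriv_on 0 S (\<lambda>t. integral {0..S} (\<lambda>s. K t s * \<sigma> s)) 0 = 0 \<and>
        deriv_on 0 S (\<lambda>t. integral {0..S} (\<lambda>s. K t s * \<sigma> s)) S = integral {0..S} (\<lambda>s. D s * \<sigma> s)"
      unfolding u_def by blast
  qed
qed

lemma singular_2x2_kernel:
  fixes a b c d :: real
  assumes "a * d - b * c = 0"
  obtains x y where "(x, y) \<noteq> (0, 0)" "a * x + b * y = 0" "c * x + d * y = 0"
proof (cases "a = 0 \<and> b = 0")
  case True
  show ?thesis
  proof (cases "c = 0 \<and> d = 0")
    case True
    with \<open>a = 0 \<and> b = 0\<close> show ?thesis by (intro that[of 1 0]) auto
  next
    case False
    with \<open>a = 0 \<and> b = 0\<close> show ?thesis by (intro that[of d "- c"]) auto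
  qed
next
  case False
  with assms show ?thesis by (intro that[of b "- a"]) (auto simp: algebra_simps)
qed

text \<open>
  Variation of constants: the solution with zero Cauchy data is corrected by a combination of the two
  fundamental solutions \<open>y1\<close>, \<open>y2\<close>.  Its coefficients solve a linear system of two equations, whose
  determinant vanishes only if some nontrivial combination satisfies the homogeneous boundary conditions,
  which nonresonance excludes.
\<close>
theorem green_function_exists:
  assumes S: "S > 0" and q: "q absolutely_integrable_on {0..S}" and nr: "nonresonant B q S"
  shows "\<exists>G. is_green B q S G"
proof -
  obtain y1 where y1: "continuous_on {0..S} y1" "ode_solution q S (\<lambda>_. 0) y1" "y1 0 = 1" "deriv_on 0 S y1 0 = 0"
    using homogeneous_solution_exists[OF S q] by blast
  obtain y2 where y2: "continuous_on {0..S} y2" "ode_solution q S (\<lambda>_. 0) y2" "y2 0 = 0" "deriv_on 0 S y2 0 = 1"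
    using homogeneous_solution_exists[OF S q] by blast
  obtain K D where K: "continuous_on ({0..S} \<times> {0..S}) (\<lambda>(t, s). K t s)" and D: "continuous_on {0..S} D"
    and KD: "\<And>\<sigma>. \<sigma> absolutely_integrable_on {0..S} \<Longrightarrow>
        ode_solution q S \<sigma> (\<lambda>t. integral {0..S} (\<lambda>s. K t s * \<sigma> s)) \<and>
        integral {0..S} (\<lambda>s. K 0 s * \<sigma> s) = 0 \<and>
        deriv_on 0 S (\<lambda>t. integral {0..S} (\<lambda>s. K t s * \<sigma> s)) 0 = 0 \<and>
        deriv_on 0 S (\<lambda>t. integral {0..S} (\<lambda>s. K t s * \<sigma> s)) S = integral {0..S} (\<lambda>s. D s * \<sigma> s)"
    using initial_value_kernel_exists[OF S q] by blast
  obtain P R where PR: "\<And>S u. boundary B S u \<longleftrightarrow> boundary_form P S u = 0 \<and> boundary_form R S u = 0"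
    using boundary_iff_forms by blast
  have Kc: "continuous_on {0..S} (K t)" if "t \<in> {0..S}" for t
    using continuous_on_section(1)[OF K that] .
  have ci: "(\<lambda>s. f s * \<sigma> s) integrable_on {0..S}"
    if "continuous_on {0..S} f" "\<sigma> absolutely_integrable_on {0..S}" for f \<sigma> :: "real \<Rightarrow> real"
    using absolutely_integrable_continuous_mult[OF that] by (simp add: absolutely_integrable_on_def)
  \<comment> \<open>The coefficients at \<open>0\<close> drop out because the particular solution has zero Cauchy data there.\<close>
  define \<kappa> where "\<kappa> = (\<lambda>(p0 :: real, p1 :: real, p2, p3) s. p2 * K S s + p3 * D s)"
  have \<kappa>: "continuous_on {0..S} (\<kappa> X)" for X
    unfolding \<kappa>_def split_def using S by (intro continuous_intros Kc D) auto
  define up where "up = (\<lambda>\<sigma> t. integral {0..S} (\<lambda>s. K t s * \<sigma> s))"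
  define sol where "sol = (\<lambda>\<sigma> c1 c2 t. up \<sigma> t + c1 * y1 t + c2 * y2 t)"
  have sol: "ode_solution q S \<sigma> (sol \<sigma> c1 c2)"
     "boundary_form X S (sol \<sigma> c1 c2) = integral {0..S} (\<lambda>s. \<kappa> X s * \<sigma> s) + c1 * boundary_form X S y1 + c2 * boundary_form X S y2"
     if \<sigma>: "\<sigma> absolutely_integrable_on {0..S}" for \<sigma> c1 c2 X
  proof -
    have up: "ode_solution q S \<sigma> (up \<sigma>)"
      using KD[OF \<sigma>] by (simp add: up_def)
    note l1 = ode_solution_linear(1)[OF S up y1(2), of c1]
    note l2 = ode_solution_linear(1)[OF S l1 y2(2), of c2]
    show "ode_solution q S \<sigma> (sol \<sigma> c1 c2)"
      using l2 by (simp add: sol_def)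
    have "boundary_form X S (up \<sigma>) = integral {0..S} (\<lambda>s. \<kappa> X s * \<sigma> s)"
    proof -
      obtain p0 p1 p2 p3 where X: "X = (p0, p1, p2, p3)" by (cases X)
      have "integral {0..S} (\<lambda>s. \<kappa> X s * \<sigma> s) = integral {0..S} (\<lambda>s. p2 * (K S s * \<sigma> s) + p3 * (D s * \<sigma> s))"
        by (simp add: \<kappa>_def X algebra_simps)
      also have "\<dots> = p2 * integral {0..S} (\<lambda>s. K S s * \<sigma> s) + p3 * integral {0..S} (\<lambda>s. D s * \<sigma> s)"
        using ci[OF Kc \<sigma>, of S] ci[OF D \<sigma>] S
        by (subst integral_add) (auto intro!: integrable_on_mult_right)
      finally show ?thesis
        using KD[OF \<sigma>] by (simp add: boundary_form_def X up_def)
    qed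
    then show "boundary_form X S (sol \<sigma> c1 c2) = integral {0..S} (\<lambda>s. \<kappa> X s * \<sigma> s) + c1 * boundary_form X S y1 + c2 * boundary_form X S y2"
      using boundary_form_linear[OF S up y1(2), of X c1] boundary_form_linear[OF S l1 y2(2), of X c2] by (simp add: sol_def)
  qed
  define det where "det = boundary_form P S y1 * boundary_form R S y2 - boundary_form P S y2 * boundary_form R S y1"
  have "det \<noteq> 0"
  proof
    assume "det = 0"
    then obtain c1 c2 where c: "(c1, c2) \<noteq> (0, 0)" "boundary_form P S y1 * c1 + boundary_form P S y2 * c2 = 0"
       "boundary_form R S y1 * c1 + boundary_form R S y2 * c2 = 0"
      using singular_2x2_kernel unfolding det_def by metis
    have z: "(\<lambda>_. 0 :: real) absolutely_integrable_on {0..S}" by simp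
    have "bvp_solution B q S (\<lambda>_. 0) (sol (\<lambda>_. 0) c1 c2)"
      using sol(1)[OF z] sol(2)[OF z] c by (simp add: bvp_solution_iff PR mult.commute)
    then have zero: "sol (\<lambda>_. 0) c1 c2 t = 0" if "t \<in> {0..S}" for t
      using nr that by (auto simp: nonresonant_def)
    have zero: "c1 * y1 t + c2 * y2 t = 0" if "t \<in> {0..S}" for t
      using zero[OF that] by (simp add: sol_def up_def)
    have "c1 = 0"
      using zero[of 0] S y1 y2 by simp
    have 0: "((\<lambda>t. c2 * y2 t) has_real_derivative 0) (at 0 within {0..S})"
      by (rule has_real_derivative_cong_on[of "\<lambda>_. 0"]) (use S zero \<open>c1 = 0\<close> in auto)
    have "y2 \<in> W21 0 S" using y2 by (simp add: ode_solution_def)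
    then have "((\<lambda>t. c2 * y2 t) has_real_derivative c2 * deriv_on 0 S y2 0) (at 0 within {0..S})"
      using S by (intro DERIV_cmult W21_has_real_derivative) auto
    then have "c2 = 0"
      using deriv_on_eq[OF 0] deriv_on_eq[of _ "c2 * deriv_on 0 S y2 0"] S y2 by fastforce
    with \<open>c1 = 0\<close> c show False by simp
  qed
  \<comment> \<open>Cramer's rule\<close>
  define c1 where "c1 = (\<lambda>s. (\<kappa> R s * boundary_form P S y2 - \<kappa> P s * boundary_form R S y2) / det)"
  define c2 where "c2 = (\<lambda>s. (\<kappa> P s * boundary_form R S y1 - \<kappa> R s * boundary_form P S y1) / det)"
  have c1: "continuous_on {0..S} c1" and c2: "continuous_on {0..S} c2"
    unfolding c1_def c2_def using \<open>det \<noteq> 0\<close> by (auto intro!: continuous_intros \<kappa>)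
  define G where "G = (\<lambda>t s. K t s + c1 s * y1 t + c2 s * y2 t)"
  have "is_green B q S G"
    unfolding is_green_def
  proof (intro conjI allI impI)
    have f: "continuous_on ({0..S} \<times> {0..S}) (\<lambda>z. f (fst z))" "continuous_on ({0..S} \<times> {0..S}) (\<lambda>z. f (snd z))"
      if "continuous_on {0..S} f" for f :: "real \<Rightarrow> real"
      by (rule continuous_on_compose2[OF that]; auto intro!: continuous_intros)+
    show "continuous_on ({0..S} \<times> {0..S}) (\<lambda>(t, s). G t s)"
      using K unfolding G_def split_def by (intro continuous_intros f c1 c2 y1 y2)
  next
    fix \<sigma> :: "real \<Rightarrow> real" assume \<sigma>: "\<sigma> absolutely_integrable_on {0..S}"
    define C1 where "C1 = integral {0..S} (\<lambda>s. c1 s * \<sigma> s)"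
    define C2 where "C2 = integral {0..S} (\<lambda>s. c2 s * \<sigma> s)"
    have Geq: "integral {0..S} (\<lambda>s. G t s * \<sigma> s) = sol \<sigma> C1 C2 t" if t: "t \<in> {0..S}" for t
    proof -
      have "integral {0..S} (\<lambda>s. G t s * \<sigma> s) =
            integral {0..S} (\<lambda>s. K t s * \<sigma> s + y1 t * (c1 s * \<sigma> s) + y2 t * (c2 s * \<sigma> s))"
        by (simp add: G_def algebra_simps)
      also have "\<dots> = up \<sigma> t + y1 t * C1 + y2 t * C2"
        using ci[OF Kc[OF t] \<sigma>] ci[OF c1 \<sigma>] ci[OF c2 \<sigma>]
        by (simp add: integral_add integrable_add integrable_on_mult_right up_def C1_def C2_def)
      finally show ?thesis by (simp add: sol_def mult.commute)
    qed
    have lin: "integral {0..S} (\<lambda>s. (\<kappa> X s * m - \<kappa> Y s * n) / det * \<sigma> s)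
        = (integral {0..S} (\<lambda>s. \<kappa> X s * \<sigma> s) * m - integral {0..S} (\<lambda>s. \<kappa> Y s * \<sigma> s) * n) / det" for X Y m n
    proof -
      have "integral {0..S} (\<lambda>s. (\<kappa> X s * m - \<kappa> Y s * n) / det * \<sigma> s)
          = integral {0..S} (\<lambda>s. (m / det) * (\<kappa> X s * \<sigma> s) - (n / det) * (\<kappa> Y s * \<sigma> s))"
        by (rule integral_cong) (simp add: diff_divide_distrib algebra_simps)
      also have "\<dots> = (m / det) * integral {0..S} (\<lambda>s. \<kappa> X s * \<sigma> s) - (n / det) * integral {0..S} (\<lambda>s. \<kappa> Y s * \<sigma> s)"
      proof -
        have i: "(\<lambda>s. z * (\<kappa> W s * \<sigma> s)) integrable_on {0..S}" for z W
          by (rule integrable_on_mult_right[OF ci[OF \<kappa> \<sigma>]])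
        show ?thesis
          unfolding integral_diff[OF i i] by simp
      qed
      finally show ?thesis by (simp add: diff_divide_distrib mult.commute)
    qed
    let ?IP = "integral {0..S} (\<lambda>s. \<kappa> P s * \<sigma> s)" and ?IR = "integral {0..S} (\<lambda>s. \<kappa> R s * \<sigma> s)"
    have C1: "C1 * det = ?IR * boundary_form P S y2 - ?IP * boundary_form R S y2"
      unfolding C1_def c1_def lin using \<open>det \<noteq> 0\<close> by simp
    have C2: "C2 * det = ?IP * boundary_form R S y1 - ?IR * boundary_form P S y1"
      unfolding C2_def c2_def lin using \<open>det \<noteq> 0\<close> by simp
    have "det * boundary_form P S (sol \<sigma> C1 C2) = det * ?IP + (C1 * det) * boundary_form P S y1 + (C2 * det) * boundary_form P S y2"
      unfolding sol(2)[OF \<sigma>] by (simp add: algebra_simps)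
    also have "\<dots> = 0"
      unfolding C1 C2 by (simp add: det_def algebra_simps)
    finally have bP: "boundary_form P S (sol \<sigma> C1 C2) = 0" using \<open>det \<noteq> 0\<close> by simp
    have "det * boundary_form R S (sol \<sigma> C1 C2) = det * ?IR + (C1 * det) * boundary_form R S y1 + (C2 * det) * boundary_form R S y2"
      unfolding sol(2)[OF \<sigma>] by (simp add: algebra_simps)
    also have "\<dots> = 0"
      unfolding C1 C2 by (simp add: det_def algebra_simps)
    finally have bR: "boundary_form R S (sol \<sigma> C1 C2) = 0" using \<open>det \<noteq> 0\<close> by simp
    have data: "AE t in lebesgue. t \<in> {0..S} \<longrightarrow> q t = q t \<and> \<sigma> t = \<sigma> t" by simp
    let ?u = "\<lambda>t. integral {0..S} (\<lambda>s. G t s * \<sigma> s)"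
    note cong = ode_solution_cong[OF S sol(1)[OF \<sigma>, of C1 C2] Geq data]
    have "boundary_form X S ?u = boundary_form X S (sol \<sigma> C1 C2)" for X
      using cong(2)[of 0] cong(2)[of S] Geq[of 0] Geq[of S] S by (cases X) (simp add: boundary_form_def)
    then show "bvp_solution B q S \<sigma> ?u"
      using cong(1) bP bR by (simp add: bvp_solution_iff PR)
  qed
  then show ?thesis by blast
qed

section \<open>The method of images\<close>

lemma green_is_green:
  assumes "S > 0" "q absolutely_integrable_on {0..S}" "nonresonant B q S"
  shows "is_green B q S (green B q S)"
  unfolding green_def using green_function_exists[OF assms] by (rule someI_ex)

text \<open>
  A list of triples encodes the terms of the method of images, so that the identities with two and with
  four terms are instances of one lemma.
\<close>
definition image_sum :: "(real \<times> real \<times> real) list \<Rightarrow> (real \<Rightarrow> real) \<Rightarrow> real \<Rightarrow> real" where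
  "image_sum xs f t = (\<Sum>(c, p, e)\<leftarrow>xs. c * f (p + e * t))"

lemma image_sum_Nil [simp]: "image_sum [] f t = 0"
  by (simp add: image_sum_def)

lemma image_sum_Cons [simp]: "image_sum ((c, p, e) # xs) f t = c * f (p + e * t) + image_sum xs f t"
  by (simp add: image_sum_def)

definition symmetric_under :: "(real \<times> real \<times> real) list \<Rightarrow> (real \<Rightarrow> real) \<Rightarrow> real \<Rightarrow> (real \<Rightarrow> real) \<Rightarrow> real \<Rightarrow> bool" where
  "symmetric_under xs a T q S \<longleftrightarrow>
     (\<forall>(c, p, e)\<in>set xs. (e = 1 \<or> e = -1) \<and> (\<forall>t\<in>{0..T}. p + e * t \<in> {0..S} \<and> q (p + e * t) = a t))"

lemma ode_solution_zero:
  assumes "S > 0"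
  shows "ode_solution q S (\<lambda>_. 0) (\<lambda>_. 0)" and "t \<in> {0..S} \<Longrightarrow> deriv_on 0 S (\<lambda>_. 0) t = 0"
proof -
  have "abs_cont_on 0 S (\<lambda>_. 0)" by (auto simp: abs_cont_on_def intro: exI[of _ 1])
  note * = ode_solutionI[OF assms, of "\<lambda>_. 0" "\<lambda>_. 0" "\<lambda>_. 0" q, OF _ this]
  show "ode_solution q S (\<lambda>_. 0) (\<lambda>_. 0)" by (rule *(1)) auto
  show "t \<in> {0..S} \<Longrightarrow> deriv_on 0 S (\<lambda>_. 0) t = 0" by (rule *(2)) auto
qed

lemma ode_solution_image_sum:
  assumes T: "T > 0" and w: "ode_solution q S \<sigma> w" and xs: "symmetric_under xs a T q S"
  shows "ode_solution a T (image_sum xs \<sigma>) (image_sum xs w)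
       \<and> (\<forall>t\<in>{0..T}. deriv_on 0 T (image_sum xs w) t = (\<Sum>(c, p, e)\<leftarrow>xs. c * (e * deriv_on 0 S w (p + e * t))))"
  using xs
proof (induction xs)
  case Nil
  have "image_sum [] f = (\<lambda>_. 0)" for f by (rule ext) simp
  then show ?case using ode_solution_zero[OF T] by simp
next
  case (Cons x xs)
  obtain c p e where x: "x = (c, p, e)" by (cases x)
  from Cons.prems have e: "e = 1 \<or> e = -1" and maps: "\<And>t. t \<in> {0..T} \<Longrightarrow> p + e * t \<in> {0..S}"
    and qa: "\<And>t. t \<in> {0..T} \<Longrightarrow> q (p + e * t) = a t" and xs: "symmetric_under xs a T q S"
    by (auto simp: symmetric_under_def x)
  note aff = ode_solution_affine[OF T w e maps]
  have "AE t in lebesgue. t \<in> {0..T} \<longrightarrow> a t = q (p + e * t) \<and> \<sigma> (p + e * t) = \<sigma> (p + e * t)"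
    using qa by simp
  note aff' = ode_solution_cong[OF T aff(1) refl this]
  have IH: "ode_solution a T (image_sum xs \<sigma>) (image_sum xs w)"
    "\<And>t. t \<in> {0..T} \<Longrightarrow> deriv_on 0 T (image_sum xs w) t = (\<Sum>(c, p, e)\<leftarrow>xs. c * (e * deriv_on 0 S w (p + e * t)))"
    using Cons.IH[OF xs] by auto
  note lin = ode_solution_linear[OF T IH(1) aff'(1), where k=c]
  have eq: "image_sum (x # xs) f = (\<lambda>t. image_sum xs f t + c * f (p + e * t))" for f
    by (rule ext) (simp add: x)
  show ?case
    unfolding eq using lin IH(2) aff(2) by (simp add: x)
qed

lemma has_integral_image_sum:
  assumes \<sigma>: "\<sigma> absolutely_integrable_on {0..T}" and t: "t \<in> {0..T}"
    and xs: "symmetric_under xs a T q S" and G: "\<And>\<tau>. \<tau> \<in> {0..S} \<Longrightarrow> continuous_on {0..T} (G \<tau>)"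
  shows "((\<lambda>s. image_sum xs (\<lambda>\<tau>. G \<tau> s) t * \<sigma> s) has_integral image_sum xs (\<lambda>\<tau>. integral {0..T} (\<lambda>s. G \<tau> s * \<sigma> s)) t) {0..T}
       \<and> continuous_on {0..T} (\<lambda>s. image_sum xs (\<lambda>\<tau>. G \<tau> s) t)"
  using xs
proof (induction xs)
  case Nil
  then show ?case by simp
next
  case (Cons x xs)
  obtain c p e where x: "x = (c, p, e)" by (cases x)
  from Cons.prems t have maps: "p + e * t \<in> {0..S}" and xs: "symmetric_under xs a T q S"
    by (auto simp: symmetric_under_def x)
  note Gc = G[OF maps]
  have "(\<lambda>s. G (p + e * t) s * \<sigma> s) integrable_on {0..T}"
    using absolutely_integrable_continuous_mult[OF Gc \<sigma>] by (simp add: absolutely_integrable_on_def)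
  then have "((\<lambda>s. c * (G (p + e * t) s * \<sigma> s)) has_integral c * integral {0..T} (\<lambda>s. G (p + e * t) s * \<sigma> s)) {0..T}"
    by (intro has_integral_mult_right integrable_integral)
  from has_integral_add[OF this conjunct1[OF Cons.IH[OF xs]]]
  have "((\<lambda>s. image_sum (x # xs) (\<lambda>\<tau>. G \<tau> s) t * \<sigma> s) has_integral image_sum (x # xs) (\<lambda>\<tau>. integral {0..T} (\<lambda>s. G \<tau> s * \<sigma> s)) t) {0..T}"
    by (simp add: x algebra_simps)
  moreover have "continuous_on {0..T} (\<lambda>s. image_sum (x # xs) (\<lambda>\<tau>. G \<tau> s) t)"
    using Cons.IH[OF xs] Gc by (simp add: x continuous_on_add continuous_on_mult_left)
  ultimately show ?case by blast
qed

lemma continuous_kernel_eq_zero: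
  fixes d :: "real \<Rightarrow> real"
  assumes T: "T > 0" and d: "continuous_on {0..T} d"
    and zero: "\<And>\<sigma>. \<sigma> absolutely_integrable_on {0..T} \<Longrightarrow> integral {0..T} (\<lambda>s. d s * \<sigma> s) = 0"
    and s: "s \<in> {0..T}"
  shows "d s = 0"
proof -
  have "integral {0..T} (\<lambda>s. d s * d s) = 0"
    by (rule zero[OF absolutely_integrable_continuous_real[OF d]])
  moreover have "continuous_on {0..T} (\<lambda>s. d s * d s)"
    by (intro continuous_intros d)
  ultimately have "\<forall>x\<in>{0..T}. d x * d x = 0"
    using integral_eq_0_iff[of 0 T "\<lambda>s. d s * d s"] T by simp
  with s show ?thesis by simp
qed

text \<open>
  The method of images.  Let \<open>w\<close> solve the large problem with the source \<open>\<sigma>\<close> extended by zero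
  beyond \<open>T\<close>.  Its sum over the images solves the equation on \<open>[0,T]\<close>: by \<open>source\<close>,
  the images of the extended source add up to \<open>\<sigma>\<close> on \<open>[0,T)\<close>.  By \<open>bc\<close> the sum satisfies the
  small boundary conditions, so nonresonance identifies it with the solution given by \<open>G0\<close>.
  Both are integrals of the arbitrary \<open>\<sigma>\<close> against continuous kernels, which therefore agree.
\<close>
theorem green_function_reflection:
  assumes T: "T > 0" and TS: "T \<le> S"
    and G0: "is_green B0 a T G0" and nr: "nonresonant B0 a T" and G: "is_green B q S G"
    and xs: "symmetric_under xs a T q S"
    and source: "\<And>f t. t \<in> {0..<T} \<Longrightarrow> (\<And>s. s > T \<Longrightarrow> f s = 0) \<Longrightarrow> image_sum xs f t = f t"
    and bc: "\<And>w v. boundary B S w \<Longrightarrow> (\<And>t. t \<in> {0..T} \<Longrightarrow> v t = image_sum xs w t) \<Longrightarrow>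
        (\<And>t. t \<in> {0..T} \<Longrightarrow> deriv_on 0 T v t = (\<Sum>(c, p, e)\<leftarrow>xs. c * (e * deriv_on 0 S w (p + e * t)))) \<Longrightarrow>
        boundary B0 T v"
    and t: "t \<in> {0..T}" and s: "s \<in> {0..T}"
  shows "G0 t s = image_sum xs (\<lambda>\<tau>. G \<tau> s) t"
proof -
  have G0c: "continuous_on {0..T} (G0 \<tau>)" if "\<tau> \<in> {0..T}" for \<tau>
    using G0 that unfolding is_green_def by (blast intro: continuous_on_section(1))
  have Gc: "continuous_on {0..T} (G \<tau>)" if "\<tau> \<in> {0..S}" for \<tau>
  proof -
    have "continuous_on {0..S} (G \<tau>)"
      using G that unfolding is_green_def by (blast intro: continuous_on_section(1))
    then show ?thesis by (rule continuous_on_subset) (use TS in auto)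
  qed
  let ?d = "\<lambda>s. G0 t s - image_sum xs (\<lambda>\<tau>. G \<tau> s) t"
  have "?d s = 0"
  proof (rule continuous_kernel_eq_zero[OF T _ _ s])
    have z: "(\<lambda>_. 0 :: real) absolutely_integrable_on {0..T}" by simp
    show "continuous_on {0..T} ?d"
      by (intro continuous_on_diff G0c t conjunct2[OF has_integral_image_sum[OF z t xs Gc]])
  next
    fix \<sigma> :: "real \<Rightarrow> real" assume \<sigma>: "\<sigma> absolutely_integrable_on {0..T}"
    define \<sigma>' where "\<sigma>' = (\<lambda>s. if s \<in> {..T} then \<sigma> s else 0)"
    define u where "u = (\<lambda>\<tau>. integral {0..T} (\<lambda>s. G0 \<tau> s * \<sigma> s))"
    define w where "w = (\<lambda>\<tau>. integral {0..S} (\<lambda>s. G \<tau> s * \<sigma>' s))"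
    have "(\<lambda>x. indicator {0..S} x *\<^sub>R \<sigma>' x) = (\<lambda>x. indicator {0..T} x *\<^sub>R \<sigma> x)"
      using TS by (auto simp: \<sigma>'_def indicator_def)
    then have "\<sigma>' absolutely_integrable_on {0..S}"
      using \<sigma> by (simp add: set_integrable_def)
    then have w: "ode_solution q S \<sigma>' w" "boundary B S w"
      using G unfolding is_green_def w_def bvp_solution_iff by blast+
    have u: "ode_solution a T \<sigma> u" "boundary B0 T u"
      using G0 \<sigma> unfolding is_green_def u_def bvp_solution_iff by blast+
    have weq: "w \<tau> = integral {0..T} (\<lambda>s. G \<tau> s * \<sigma> s)" for \<tau>
    proof -
      have "w \<tau> = integral {0..S} (\<lambda>s. if s \<in> {..T} then G \<tau> s * \<sigma> s else 0)"
        unfolding w_def by (rule integral_cong) (simp add: \<sigma>'_def)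
      also have "{0..S} \<inter> {..T} = {0..T}" using TS by auto
      then have "integral {0..S} (\<lambda>s. if s \<in> {..T} then G \<tau> s * \<sigma> s else 0) = integral {0..T} (\<lambda>s. G \<tau> s * \<sigma> s)"
        by (simp only: integral_restrict_Int Int_commute)
      finally show ?thesis .
    qed
    define v where "v = image_sum xs w"
    have v: "ode_solution a T (image_sum xs \<sigma>') v"
      "\<And>t. t \<in> {0..T} \<Longrightarrow> deriv_on 0 T v t = (\<Sum>(c, p, e)\<leftarrow>xs. c * (e * deriv_on 0 S w (p + e * t)))"
      using ode_solution_image_sum[OF T w(1) xs] by (auto simp: v_def)
    have vb: "boundary B0 T v"
      by (rule bc[OF w(2) _ v(2)]) (simp_all add: v_def)
    have "AE t in lebesgue. t \<noteq> T"
      by (rule AE_I'[of "{T}"]) (auto simp flip: negligible_iff_null_sets)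
    then have data: "AE t in lebesgue. t \<in> {0..T} \<longrightarrow> a t = a t \<and> 0 = \<sigma> t + (- 1) * image_sum xs \<sigma>' t"
    proof (eventually_elim, intro impI)
      fix t assume "t \<noteq> T" "t \<in> {0..T}"
      then have "image_sum xs \<sigma>' t = \<sigma>' t" by (intro source) (auto simp: \<sigma>'_def)
      then show "a t = a t \<and> 0 = \<sigma> t + (- 1) * image_sum xs \<sigma>' t"
        using \<open>t \<in> {0..T}\<close> by (simp add: \<sigma>'_def)
    qed
    note lin = ode_solution_linear(1)[OF T u(1) v(1), where k="- 1"]
    obtain P R where PR: "\<And>S u. boundary B0 S u \<longleftrightarrow> boundary_form P S u = 0 \<and> boundary_form R S u = 0"
      using boundary_iff_forms by blast
    have "boundary B0 T (\<lambda>t. u t + (- 1) * v t)"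
      using u(2) vb unfolding PR boundary_form_linear[OF T u(1) v(1)] by simp
    moreover have "ode_solution a T (\<lambda>_. 0) (\<lambda>t. u t + (- 1) * v t)"
      by (rule ode_solution_cong(1)[OF T lin refl data])
    ultimately have uv: "u t + (- 1) * v t = 0"
      using nr t unfolding nonresonant_def bvp_solution_iff by blast
    have "((\<lambda>s. image_sum xs (\<lambda>\<tau>. G \<tau> s) t * \<sigma> s) has_integral v t) {0..T}"
    proof -
      have "w = (\<lambda>\<tau>. integral {0..T} (\<lambda>s. G \<tau> s * \<sigma> s))"
        using weq by (rule ext)
      then show ?thesis
        using conjunct1[OF has_integral_image_sum[OF \<sigma> t xs Gc]] by (simp only: v_def)
    qed
    moreover have "((\<lambda>s. G0 t s * \<sigma> s) has_integral u t) {0..T}"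
      unfolding u_def using absolutely_integrable_continuous_mult[OF G0c[OF t] \<sigma>]
      by (intro integrable_integral) (simp add: absolutely_integrable_on_def)
    ultimately have "((\<lambda>s. G0 t s * \<sigma> s - image_sum xs (\<lambda>\<tau>. G \<tau> s) t * \<sigma> s) has_integral u t - v t) {0..T}"
      by (intro has_integral_diff)
    then have "integral {0..T} (\<lambda>s. ?d s * \<sigma> s) = u t - v t"
      unfolding left_diff_distrib by (rule integral_unique)
    then show "integral {0..T} (\<lambda>s. ?d s * \<sigma> s) = 0"
      using uv by simp
  qed
  then show ?thesis by simp
qed

lemma even_ext_left: "t \<le> T \<Longrightarrow> even_ext T a t = a t"
  by (simp add: even_ext_def)

lemma even_ext_reflect: "t \<le> T \<Longrightarrow> even_ext T a (2 * T - t) = a t"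
  by (cases "t = T") (auto simp: even_ext_def)

lemma even_ext_absolutely_integrable:
  assumes T: "T > 0" and a: "a absolutely_integrable_on {0..T}"
  shows "even_ext T a absolutely_integrable_on {0..2 * T}"
proof -
  have im: "(\<lambda>t. 2 * T - t) ` {T..2 * T} = {0..T}"
    using T by (auto intro!: image_eqI[where x="2 * T - _"])
  have "(\<lambda>t. \<bar>- 1\<bar> * a (2 * T - t)) absolutely_integrable_on {T..2 * T}"
  proof -
    have der: "((\<lambda>t. 2 * T - t) has_real_derivative - 1) (at x within {T..2 * T})" for x
      by (auto intro!: derivative_eq_intros)
    have inj: "inj_on (\<lambda>t. 2 * T - t) {T..2 * T}"
      by (simp add: inj_on_def)
    show ?thesis
      using has_absolute_integral_change_of_variables_1'[OF _ der inj, of a] a unfolding im by auto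
  qed
  then have "even_ext T a absolutely_integrable_on {T..2 * T}"
  proof (rule set_integrable_cong[THEN iffD1, rotated -1])
    fix t assume "t \<in> {T..2 * T}"
    then show "\<bar>- 1\<bar> * a (2 * T - t) = even_ext T a t"
      using even_ext_reflect[of "2 * T - t" T a] by simp
  qed auto
  moreover have "even_ext T a absolutely_integrable_on {0..T}"
    using a by (rule set_integrable_cong[THEN iffD1, rotated -1]) (auto simp: even_ext_left)
  ultimately have "even_ext T a absolutely_integrable_on {0..T} \<union> {T..2 * T}"
    by (intro absolutely_integrable_Un) auto
  moreover have "{0..T} \<union> {T..2 * T} = {0..2 * T}" using T by auto
  ultimately show ?thesis by simp
qed

theorem mainTheorem3:
  fixes T :: real and a :: "real \<Rightarrow> real"
  assumes "T > 0"
    and "a absolutely_integrable_on {0..T}"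
  shows "(nonresonant Mixed1 a T \<and> nonresonant Antiperiodic (even_ext T a) (2 * T) \<longrightarrow>
         (\<forall>t\<in>{0..T}. \<forall>s\<in>{0..T}.
           green Mixed1 a T t s =
               green Antiperiodic (even_ext T a) (2 * T) t s
             - green Antiperiodic (even_ext T a) (2 * T) (2 * T - t) s)) \<and>
        (nonresonant Mixed1 a T \<and> nonresonant Neumann (even_ext T a) (2 * T) \<longrightarrow>
         (\<forall>t\<in>{0..T}. \<forall>s\<in>{0..T}.
           green Mixed1 a T t s =
               green Neumann (even_ext T a) (2 * T) t s
             - green Neumann (even_ext T a) (2 * T) (2 * T - t) s)) \<and>
        (nonresonant Mixed1 a T \<and> nonresonant Periodic (even_ext (2 * T) (even_ext T a)) (4 * T) \<longrightarrow>
         (\<forall>t\<in>{0..T}. \<forall>s\<in>{0..T}.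
           green Mixed1 a T t s =
               green Periodic (even_ext (2 * T) (even_ext T a)) (4 * T) t s
             + green Periodic (even_ext (2 * T) (even_ext T a)) (4 * T) (4 * T - t) s
             - green Periodic (even_ext (2 * T) (even_ext T a)) (4 * T) (2 * T - t) s
             - green Periodic (even_ext (2 * T) (even_ext T a)) (4 * T) (2 * T + t) s)) \<and>
        (nonresonant Mixed2 a T \<and> nonresonant Antiperiodic (even_ext T a) (2 * T) \<longrightarrow>
         (\<forall>t\<in>{0..T}. \<forall>s\<in>{0..T}.
           green Mixed2 a T t s =
               green Antiperiodic (even_ext T a) (2 * T) t s
             + green Antiperiodic (even_ext T a) (2 * T) (2 * T - t) s)) \<and>
        (nonresonant Mixed2 a T \<and> nonresonant Dirichlet (even_ext T a) (2 * T) \<longrightarrow>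
         (\<forall>t\<in>{0..T}. \<forall>s\<in>{0..T}.
           green Mixed2 a T t s =
               green Dirichlet (even_ext T a) (2 * T) t s
             + green Dirichlet (even_ext T a) (2 * T) (2 * T - t) s)) \<and>
        (nonresonant Mixed2 a T \<and> nonresonant Periodic (even_ext (2 * T) (even_ext T a)) (4 * T) \<longrightarrow>
         (\<forall>t\<in>{0..T}. \<forall>s\<in>{0..T}.
           green Mixed2 a T t s =
               green Periodic (even_ext (2 * T) (even_ext T a)) (4 * T) t s
             - green Periodic (even_ext (2 * T) (even_ext T a)) (4 * T) (4 * T - t) s
             + green Periodic (even_ext (2 * T) (even_ext T a)) (4 * T) (2 * T - t) s
             - green Periodic (even_ext (2 * T) (even_ext T a)) (4 * T) (2 * T + t) s))"
proof -
  note T = assms(1) and a = assms(2)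
  let ?a2 = "even_ext T a" and ?a4 = "even_ext (2 * T) (even_ext T a)"
  have a2: "?a2 absolutely_integrable_on {0..2 * T}"
    by (rule even_ext_absolutely_integrable[OF T a])
  have a4: "?a4 absolutely_integrable_on {0..4 * T}"
    using even_ext_absolutely_integrable[OF _ a2] T by simp
  have T2: "2 * T > 0" and T4: "4 * T > 0" using T by auto
  have ge: "T \<le> 2 * T" "T \<le> 4 * T" using T by auto
  have sym2: "symmetric_under [(1, 0, 1), (c, 2 * T, - 1)] a T ?a2 (2 * T)" for c
    using even_ext_left[of _ T a] even_ext_reflect[of _ T a] by (auto simp: symmetric_under_def)
  have sym4: "symmetric_under [(1, 0, 1), (c1, 4 * T, - 1), (c2, 2 * T, - 1), (c3, 2 * T, 1)] a T ?a4 (4 * T)" for c1 c2 c3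
  proof -
    have "?a4 t = a t" "?a4 (4 * T - t) = a t" "?a4 (2 * T - t) = a t" "?a4 (2 * T + t) = a t" if "t \<in> {0..T}" for t
      using even_ext_left[of t "2 * T" ?a2] even_ext_reflect[of t "2 * T" ?a2]
        even_ext_left[of "2 * T - t" "2 * T" ?a2] even_ext_reflect[of "2 * T - t" "2 * T" ?a2]
        even_ext_left[of t T a] even_ext_reflect[of t T a] that by (auto simp: algebra_simps)
    then show ?thesis by (auto simp: symmetric_under_def)
  qed
  note M = green_is_green[OF T a] and G2 = green_is_green[OF T2 a2] and G4 = green_is_green[OF T4 a4]
  have source2: "image_sum [(1, 0, 1), (c, 2 * T, - 1)] f t = f t"
    if "t \<in> {0..<T}" "\<And>s. s > T \<Longrightarrow> f s = 0" for c f t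
    using that(1) that(2)[of "2 * T - t"] by simp
  have source4: "image_sum [(1, 0, 1), (c1, 4 * T, - 1), (c2, 2 * T, - 1), (c3, 2 * T, 1)] f t = f t"
    if "t \<in> {0..<T}" "\<And>s. s > T \<Longrightarrow> f s = 0" for c1 c2 c3 f t
    using that(1) that(2)[of "2 * T - t"] that(2)[of "4 * T - t"] that(2)[of "2 * T + t"] by simp
  have ends: "0 \<in> {0..T}" "T \<in> {0..T}" using T by auto
  \<comment> \<open>In each case the boundary conditions of the mixed problem remain to be checked: at \<open>0\<close> and \<open>T\<close> the images of \<open>w\<close> and \<open>w'\<close> cancel in pairs.\<close>
  show ?thesis
  proof (intro conjI impI ballI; elim conjE)
    fix t s assume nr: "nonresonant Mixed1 a T" "nonresonant Antiperiodic ?a2 (2 * T)" and ts: "t \<in> {0..T}" "s \<in> {0..T}"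
    show "green Mixed1 a T t s = green Antiperiodic ?a2 (2 * T) t s - green Antiperiodic ?a2 (2 * T) (2 * T - t) s"
      using green_function_reflection[OF T ge(1) M[OF nr(1)] nr(1) G2[OF nr(2)] sym2[of "- 1"] source2 _ ts] ends by simp
  next
    fix t s assume nr: "nonresonant Mixed1 a T" "nonresonant Neumann ?a2 (2 * T)" and ts: "t \<in> {0..T}" "s \<in> {0..T}"
    show "green Mixed1 a T t s = green Neumann ?a2 (2 * T) t s - green Neumann ?a2 (2 * T) (2 * T - t) s"
      using green_function_reflection[OF T ge(1) M[OF nr(1)] nr(1) G2[OF nr(2)] sym2[of "- 1"] source2 _ ts] ends by simp
  next
    fix t s assume nr: "nonresonant Mixed1 a T" "nonresonant Periodic ?a4 (4 * T)" and ts: "t \<in> {0..T}" "s \<in> {0..T}"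
    show "green Mixed1 a T t s = green Periodic ?a4 (4 * T) t s + green Periodic ?a4 (4 * T) (4 * T - t) s
             - green Periodic ?a4 (4 * T) (2 * T - t) s - green Periodic ?a4 (4 * T) (2 * T + t) s"
      using green_function_reflection[OF T ge(2) M[OF nr(1)] nr(1) G4[OF nr(2)] sym4[of 1 "- 1" "- 1"] source4 _ ts] ends by simp
  next
    fix t s assume nr: "nonresonant Mixed2 a T" "nonresonant Antiperiodic ?a2 (2 * T)" and ts: "t \<in> {0..T}" "s \<in> {0..T}"
    show "green Mixed2 a T t s = green Antiperiodic ?a2 (2 * T) t s + green Antiperiodic ?a2 (2 * T) (2 * T - t) s"
      using green_function_reflection[OF T ge(1) M[OF nr(1)] nr(1) G2[OF nr(2)] sym2[of 1] source2 _ ts] ends by simp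
  next
    fix t s assume nr: "nonresonant Mixed2 a T" "nonresonant Dirichlet ?a2 (2 * T)" and ts: "t \<in> {0..T}" "s \<in> {0..T}"
    show "green Mixed2 a T t s = green Dirichlet ?a2 (2 * T) t s + green Dirichlet ?a2 (2 * T) (2 * T - t) s"
      using green_function_reflection[OF T ge(1) M[OF nr(1)] nr(1) G2[OF nr(2)] sym2[of 1] source2 _ ts] ends by simp
  next
    fix t s assume nr: "nonresonant Mixed2 a T" "nonresonant Periodic ?a4 (4 * T)" and ts: "t \<in> {0..T}" "s \<in> {0..T}"
    show "green Mixed2 a T t s = green Periodic ?a4 (4 * T) t s - green Periodic ?a4 (4 * T) (4 * T - t) s
             + green Periodic ?a4 (4 * T) (2 * T - t) s - green Periodic ?a4 (4 * T) (2 * T + t) s"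
      using green_function_reflection[OF T ge(2) M[OF nr(1)] nr(1) G4[OF nr(2)] sym4[of "- 1" 1 "- 1"] source4 _ ts] ends by simp
  qed
qed

end
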